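(* (i) Let $E=E(\{c_n\}_{n\in\mathbb{N}})\subset\mathbb{R}$ with $c_n=1-\frac{1}{2n}$. Then there exist $C_0>0$ and $s\in(0,\frac13)$ such that $\mathcal{L}_{Q_n}(s)\leq C_0\,\mathcal{S}_{Q_n}(s)$ for every $n\in\mathbb{N}_0$. (ii) Let $E=E(\{c_n\}_{n\in\mathbb{N}})\subset\mathbb{R}$ with $c_n=\frac12$ for all $n$. Then for every $t\in(0,\frac18)$, $$\frac{\mathcal{L}_{Q_n}(t)}{\mathcal{S}_{Q_n}(t)}\to\infty\quad\text{as }n\to\infty.$$
   Context: Construction of $E(\{c_n\})$. Given a sequence $\{c_n\}_{n\in\mathbb{N}}\subset(0,1]$ ($\mathbb{N}=\{1,2,\dots\}$), set $E_0=\{0,1\}$ and, for $n\geq1$, $E_n=E_{n-1}\cup E^1_{n-1}\cup E^2_{n-1}$, where $E^1_{n-1}$ is a translate of $c_nE_{n-1}$ whose first (smallest) point is the last (largest) point of $E_{n-1}$, and $E^2_{n-1}$ is a translate of $E_{n-1}$ whose first point is the last point of $E^1_{n-1}$. Put $E^+(\{c_n\})=\bigcup_{n\geq0}E_n$, $E^-(\{c_n\})=-E^+(\{c_n\})$ and $E(\{c_n\})=E^-(\{c_n\})\cup E^+(\{c_n\})$. For $n\in\mathbb{N}_0$, $Q_n=[0,\max E_n)$. Dyadic notions on $\mathbb{R}$. $|A|$ is the Lebesgue measure of $A$; a cube in $\mathbb{R}$ is an interval $[a,b)$ with $a<b$, and $l([a,b))=b-a$. For a cube $Q_0$, $\mathcal{D}(Q_0)=\bigcup_{j\geq0}\mathcal{D}^j(Q_0)$,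 where $\mathcal{D}^j(Q_0)$ is the family of $2^{j}$ pairwise disjoint cubes of length $2^{-j}l(Q_0)$ whose union is $Q_0$. For $Q\in\mathcal{D}^j(Q_0)$ with $j\geq1$, $\pi Q$ is the unique cube of $\mathcal{D}^{j-1}(Q_0)$ containing $Q$. Define $\mathcal{D}_E(Q_0)=\{Q\in\mathcal{D}(Q_0): Q\cap\overline{E}=\emptyset,\ \pi Q\cap\overline{E}\neq\emptyset\}$. For a set $E$ with $|\overline{E}|=0$, a cube $Q_0$ intersecting $\overline{E}$ and $t\in(0,1)$, put $$\mathcal{L}_{Q_0}(t)=\max\Big\{L\geq0:\sum_{Q\in\mathcal{D}_E(Q_0),\,l(Q)\geq L}\tfrac{|Q|}{|Q_0|}\geq t\Big\},\qquad \mathcal{S}_{Q_0}(t)=\min\Big\{L\geq0:\sum_{Q\in\mathcal{D}_E(Q_0),\,l(Q)\leq L}\tfrac{|Q|}{|Q_0|}\geq t\Big\}$$ (these exist and are positive). *)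

theory Defs
  imports "HOL-Analysis.Analysis"
begin

section \<open>The sets \<open>E({c\<^sub>n})\<close>\<close>

definition translate_first_to :: "real \<Rightarrow> real set \<Rightarrow> real set" where
  "translate_first_to p A = (\<lambda>x. x + (p - Min A)) ` A"

text \<open>The sequence is indexed from 1 on; the value \<^term>\<open>c 0\<close> is never used.\<close>

fun E_stage :: "(nat \<Rightarrow> real) \<Rightarrow> nat \<Rightarrow> real set" where
  "E_stage c 0 = {0, 1}"
| "E_stage c (Suc n) =
     (let A = E_stage c n;
          A1 = translate_first_to (Max A) ((\<lambda>x. c (Suc n) * x) ` A);
          A2 = translate_first_to (Max A1) A
      in A \<union> A1 \<union> A2)"

definition E_plus :: "(nat \<Rightarrow> real) \<Rightarrow> real set" where
  "E_plus c = (\<Union>n. E_stage c n)"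

definition E_minus :: "(nat \<Rightarrow> real) \<Rightarrow> real set" where
  "E_minus c = uminus ` E_plus c"

definition E_set :: "(nat \<Rightarrow> real) \<Rightarrow> real set" where
  "E_set c = E_minus c \<union> E_plus c"

definition Q_stage :: "(nat \<Rightarrow> real) \<Rightarrow> nat \<Rightarrow> real set" where
  "Q_stage c n = {0..<Max (E_stage c n)}"

section \<open>Dyadic cubes on the real line\<close>

definition is_cube :: "real set \<Rightarrow> bool" where
  "is_cube Q \<longleftrightarrow> (\<exists>a b. a < b \<and> Q = {a..<b})"

definition side_length :: "real set \<Rightarrow> real" where
  "side_length Q = Sup Q - Inf Q"

text \<open>Meaningful for a cube \<^term>\<open>Q0\<close>; see \<open>dyadic_gen_partition\<close> below.\<close>

definition dyadic_gen :: "nat \<Rightarrow> real set \<Rightarrow> real set set" where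
  "dyadic_gen j Q0 =
     {{Inf Q0 + real k * (side_length Q0 / 2 ^ j) ..< Inf Q0 + real (Suc k) * (side_length Q0 / 2 ^ j)}
        | k. k < 2 ^ j}"

definition dyadic :: "real set \<Rightarrow> real set set" where
  "dyadic Q0 = (\<Union>j. dyadic_gen j Q0)"

text \<open>Unspecified for \<open>Q = Q0\<close>, which has no parent.\<close>

definition dyadic_parent :: "real set \<Rightarrow> real set \<Rightarrow> real set" where
  "dyadic_parent Q0 Q =
     (THE P. \<exists>j. Q \<in> dyadic_gen (Suc j) Q0 \<and> P \<in> dyadic_gen j Q0 \<and> Q \<subseteq> P)"

text \<open>\<open>Q0\<close> itself is removed because it has no parent. In all cases of interest
  \<open>Q0\<close> meets \<open>closure E\<close>, so it would not satisfy the first condition anyway.\<close>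

definition dyadic_free :: "real set \<Rightarrow> real set \<Rightarrow> real set set" where
  "dyadic_free E Q0 =
     {Q \<in> dyadic Q0 - {Q0}. Q \<inter> closure E = {} \<and> dyadic_parent Q0 Q \<inter> closure E \<noteq> {}}"

text \<open>The families summed over below may be infinite. They consist of pairwise disjoint
  subcubes of \<open>Q0\<close>, so the sums always converge. \<open>GREATEST\<close> and \<open>LEAST\<close> are the
  maximum and minimum of an (infinite) set of reals, not its supremum and infimum.\<close>

definition large_scale :: "real set \<Rightarrow> real set \<Rightarrow> real \<Rightarrow> real" where
  "large_scale E Q0 t =
     (GREATEST L. L \<ge> 0 \<and>
        (\<Sum>\<^sub>\<infinity>Q\<in>{Q \<in> dyadic_free E Q0. side_length Q \<ge> L}. measure lebesgue Q / measure lebesgue Q0) \<ge> t)"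

definition small_scale :: "real set \<Rightarrow> real set \<Rightarrow> real \<Rightarrow> real" where
  "small_scale E Q0 t =
     (LEAST L. L \<ge> 0 \<and>
        (\<Sum>\<^sub>\<infinity>Q\<in>{Q \<in> dyadic_free E Q0. side_length Q \<le> L}. measure lebesgue Q / measure lebesgue Q0) \<ge> t)"

lemma side_length_cube: "a < b \<Longrightarrow> side_length {a..<b} = b - a"
  by (simp add: side_length_def)

lemma dyadic_gen_partition:
  assumes "is_cube Q0"
  shows "\<Union> (dyadic_gen j Q0) = Q0"
    and "disjoint (dyadic_gen j Q0)"
    and "card (dyadic_gen j Q0) = 2 ^ j"
    and "\<And>Q. Q \<in> dyadic_gen j Q0 \<Longrightarrow> is_cube Q \<and> side_length Q = side_length Q0 / 2 ^ j"
proof -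
  obtain a b where ab: "a < b" "Q0 = {a..<b}"
    using assms by (auto simp: is_cube_def)
  define d where "d = (b - a) / 2 ^ j"
  have d: "d > 0" using ab by (simp add: d_def)
  have b: "b = a + 2 ^ j * d" by (simp add: d_def)
  define I where "I = (\<lambda>k::nat. {a + real k * d ..< a + real (Suc k) * d})"
  have gen: "dyadic_gen j Q0 = I ` {..<2 ^ j}"
    using ab by (auto simp: dyadic_gen_def I_def side_length_cube d_def)
  have I_iff: "x \<in> I k \<longleftrightarrow> \<lfloor>(x - a) / d\<rfloor> = int k" for x k
    using d by (auto simp: I_def floor_eq_iff field_simps)
  have ne: "a + real k * d \<in> I k" for k
    using d by (simp add: I_def)
  have eq: "k = l" if "x \<in> I k" "x \<in> I l" for x k l
    using that by (simp add: I_iff)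
  show "\<Union> (dyadic_gen j Q0) = Q0"
  proof (intro equalityI subsetI)
    fix x assume "x \<in> \<Union> (dyadic_gen j Q0)"
    then obtain k where k: "k < 2 ^ j" "x \<in> I k" by (auto simp: gen)
    have "real (Suc k) \<le> 2 ^ j"
      using k(1) by (metis Suc_leI of_nat_le_iff of_nat_numeral of_nat_power)
    then have "real (Suc k) * d \<le> 2 ^ j * d" using d by (intro mult_right_mono) auto
    moreover have "0 \<le> real k * d" using d by simp
    ultimately show "x \<in> Q0" using k(2) unfolding ab(2) I_def b by auto
  next
    fix x assume "x \<in> Q0"
    then have x: "a \<le> x" "x < a + 2 ^ j * d" using ab b by auto
    then have r: "0 \<le> (x - a) / d" "(x - a) / d < 2 ^ j"
      using d by (auto simp: field_simps)
    define k where "k = nat \<lfloor>(x - a) / d\<rfloor>"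
    have "x \<in> I k" using r by (simp add: I_iff k_def)
    moreover have "k < 2 ^ j"
      using r by (simp add: k_def nat_less_iff floor_less_iff)
    ultimately show "x \<in> \<Union> (dyadic_gen j Q0)" by (auto simp: gen)
  qed
  show "disjoint (dyadic_gen j Q0)"
    unfolding gen disjoint_def using eq by blast
  have "inj_on I {..<2 ^ j}"
    using eq ne by (metis inj_onI)
  then show "card (dyadic_gen j Q0) = 2 ^ j"
    by (simp add: gen card_image)
  show "is_cube Q \<and> side_length Q = side_length Q0 / 2 ^ j" if "Q \<in> dyadic_gen j Q0" for Q
  proof -
    from that obtain k where Q: "Q = I k" unfolding gen by blast
    have lt: "a + real k * d < a + real (Suc k) * d" using d by (simp add: field_simps)
    moreover have "side_length Q = d"
      unfolding Q I_def side_length_cube[OF lt] by (simp add: algebra_simps)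
    moreover have "is_cube Q"
      using lt unfolding is_cube_def Q I_def by blast
    ultimately show ?thesis
      using ab by (simp add: side_length_cube d_def)
  qed
qed

end

theory Submission
  imports Defs
begin

text \<open>
  A stopping cube of length at most \<open>L\<close> lies within \<open>2 L\<close> of an end point of the gap of
  \<open>E\<close> containing it, and its length is at most that of the gap. Hence, up to constants, the two
  scales are quantiles of the gap length, where each gap of \<open>E\<^sub>n\<close> is weighted by its length.

  (i) There are \<open>3\<^sup>n\<close> gaps, so \<open>\<S>(s) \<ge> s |Q\<^sub>n| / (4 3\<^sup>n)\<close>. By Markov's inequality
  \<open>\<L>(s) \<le> \<Sum> l\<^sup>2 / (s |Q\<^sub>n|)\<close>, the sum being over the lengths \<open>l\<close> of all gaps. Since
  \<open>\<Sum> l\<^sup>2 = \<Prod> (2 + c\<^sub>i\<^sup>2)\<close> and \<open>|Q\<^sub>n| = \<Prod> (2 + c\<^sub>i)\<close>, the quotient is at most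
  \<open>4 / s\<^sup>2\<close> times the product of \<open>3 (2 + c\<^sub>i\<^sup>2) / (2 + c\<^sub>i)\<^sup>2 = 1 + O(1 / i\<^sup>2)\<close>.

  (ii) The length of a random gap of \<open>E\<^sub>n\<close> is \<open>2\<close> to the minus a binomial variable with
  parameters \<open>n\<close> and \<open>1 / 5\<close>. The point masses of this variable tend to \<open>0\<close> uniformly, so
  its quartiles drift arbitrarily far apart.
\<close>

subsection \<open>Sums of measures over countable disjoint families\<close>

text \<open>Countable additivity in the form of an unordered sum, the form in which the definitions
  of the two scales add up measures of cubes.\<close>

lemma has_sum_measure_Union:
  assumes "countable F" "disjoint F" "F \<subseteq> sets M" "\<Union>F \<in> fmeasurable M"
  shows "(measure M has_sum measure M (\<Union>F)) F"
proof (cases "finite F")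
  case True
  have fm: "A \<in> fmeasurable M" if "A \<in> F" for A
    using assms that by (meson Sup_upper fmeasurableI2 subsetD)
  have "measure M (\<Union>F) = sum (measure M) F"
    using measure_Union'[OF True, of M] fm assms(2)
    by (auto simp: disjoint_def pairwise_def disjnt_def measure_Union')
  then show ?thesis
    using True by (simp add: has_sum_finite)
next
  case False
  define f where "f = from_nat_into F"
  have bij: "bij_betw f UNIV F"
    unfolding f_def using assms(1) False by (rule bij_betw_from_nat_into)
  have "range f \<subseteq> sets M" using bij assms(3) by (auto simp: bij_betw_def)
  moreover have "disjoint_family f"
    unfolding disjoint_family_on_def
  proof (intro ballI impI)
    fix m n :: nat assume "m \<noteq> n"
    then have "f m \<noteq> f n" using bij by (meson UNIV_I bij_betw_def inj_on_eq_iff)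
    moreover have "f m \<in> F" "f n \<in> F" using bij by (auto simp: bij_betw_def)
    ultimately show "f m \<inter> f n = {}" using assms(2) by (auto simp: disjoint_def)
  qed
  moreover have Un: "(\<Union>n. f n) = \<Union>F" using bij by (auto simp: bij_betw_def)
  moreover have "emeasure M (\<Union>n. f n) \<noteq> \<infinity>"
    using assms(4) Un by (auto simp: fmeasurable_def)
  ultimately have "(\<lambda>n. measure M (f n)) sums measure M (\<Union>F)"
    using measure_UNION[of f M] by simp
  then have "((\<lambda>n. measure M (f n)) has_sum measure M (\<Union>F)) UNIV"
    by (intro sums_nonneg_imp_has_sum) auto
  then show ?thesis
    using has_sum_reindex_bij_betw[OF bij, of "measure M"] by simp
qed

subsection \<open>Gaps of finite sets\<close>

text \<open>Gaps are kept as pairs of end points rather than as open intervals, so that affine maps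
  act on them coordinatewise.\<close>

definition gaps :: "real set \<Rightarrow> (real \<times> real) set" where
  "gaps P = {(a, b). a \<in> P \<and> b \<in> P \<and> a < b \<and> {a<..<b} \<inter> P = {}}"

lemma gaps_dichotomy: "(a, b) \<in> gaps P \<Longrightarrow> p \<in> P \<Longrightarrow> p \<le> a \<or> b \<le> p"
  unfolding gaps_def by (simp add: disjoint_iff) (meson not_le)

lemma gapsI:
  "a \<in> P \<Longrightarrow> b \<in> P \<Longrightarrow> a < b \<Longrightarrow> (\<And>p. p \<in> P \<Longrightarrow> p \<le> a \<or> b \<le> p) \<Longrightarrow> (a, b) \<in> gaps P"
  unfolding gaps_def by (auto simp: disjoint_iff not_less) (meson not_le)

lemma gapsD: "(a, b) \<in> gaps P \<Longrightarrow> a \<in> P \<and> b \<in> P \<and> a < b"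
  unfolding gaps_def by simp

lemma finite_gaps: "finite P \<Longrightarrow> finite (gaps P)"
  by (rule finite_subset[of _ "P \<times> P"]) (auto simp: gaps_def)

lemma gap_around:
  assumes "finite P" "p \<in> P" "q \<in> P" "p \<le> x" "x \<le> q" "x \<notin> P"
  obtains a b where "(a, b) \<in> gaps P" "a < x" "x < b"
proof -
  define a where "a = Max {r \<in> P. r \<le> x}"
  define b where "b = Min {r \<in> P. x \<le> r}"
  have a: "a \<in> P" "a \<le> x"
    using Max_in[of "{r \<in> P. r \<le> x}"] assms(1,2,4) unfolding a_def by fastforce+
  have b: "b \<in> P" "x \<le> b"
    using Min_in[of "{r \<in> P. x \<le> r}"] assms(1,3,5) unfolding b_def by fastforce+
  have "r \<le> a" if "r \<in> P" "r \<le> x" for r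
    unfolding a_def using assms(1) that by (intro Max_ge) auto
  moreover have "b \<le> r" if "r \<in> P" "x \<le> r" for r
    unfolding b_def using assms(1) that by (intro Min_le) auto
  moreover have less: "a < x" "x < b" using a b assms(6) by (metis less_le)+
  ultimately have "(a, b) \<in> gaps P" using a(1) b(1) by (intro gapsI) (auto, meson linear)
  then show ?thesis using less that by blast
qed

lemma gap_unique:
  assumes "(a, b) \<in> gaps P" "(a', b') \<in> gaps P" "x \<in> {a<..<b}" "x \<in> {a'<..<b'}"
  shows "a = a' \<and> b = b'"
proof -
  have "a' \<le> a \<or> b \<le> a'" "b' \<le> a \<or> b \<le> b'" "a \<le> a' \<or> b' \<le> a" "b \<le> a' \<or> b' \<le> b"
    using assms(1,2) gaps_dichotomy gapsD by metis+
  then show ?thesis using assms(3,4) by auto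
qed

text \<open>The shared point \<open>m\<close> belongs to the union and separates its two halves, so
  no gap can straddle it. Hence gap sums are additive when sets are glued end to end.\<close>

lemma gaps_Un:
  assumes "m \<in> A" "m \<in> B" "\<And>x. x \<in> A \<Longrightarrow> x \<le> m" "\<And>x. x \<in> B \<Longrightarrow> m \<le> x"
  shows "gaps (A \<union> B) = gaps A \<union> gaps B" "gaps A \<inter> gaps B = {}"
proof -
  have "gaps (A \<union> B) \<subseteq> gaps A \<union> gaps B"
  proof
    fix z assume z: "z \<in> gaps (A \<union> B)"
    obtain a b where [simp]: "z = (a, b)" by (cases z)
    have ab: "a \<in> A \<union> B" "b \<in> A \<union> B" "a < b" "{a<..<b} \<inter> (A \<union> B) = {}"
      using z by (auto simp: gaps_def)
    have "b \<le> m \<or> m \<le> a" using gaps_dichotomy[of a b _ m] z assms(1) by auto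
    then show "z \<in> gaps A \<union> gaps B"
    proof
      assume "b \<le> m"
      then have "x \<in> A" if "x = a \<or> x = b" for x
        using that ab(1-3) assms(1) assms(4)[of x] by auto
      then show ?thesis using ab by (auto simp: gaps_def)
    next
      assume "m \<le> a"
      then have "x \<in> B" if "x = a \<or> x = b" for x
        using that ab(1-3) assms(2) assms(3)[of x] by auto
      then show ?thesis using ab by (auto simp: gaps_def)
    qed
  qed
  moreover have "z \<in> gaps (A \<union> B)" if z: "z \<in> gaps A" for z
  proof -
    obtain a b where ab: "z = (a, b)" by (cases z)
    show ?thesis
      using gapsD[of a b A] gaps_dichotomy[of a b A] z assms(3)[of b] assms(4)
      unfolding ab by (intro gapsI) (auto intro: order_trans)
  qed
  moreover have "z \<in> gaps (A \<union> B)" if z: "z \<in> gaps B" for z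
  proof -
    obtain a b where ab: "z = (a, b)" by (cases z)
    show ?thesis
      using gapsD[of a b B] gaps_dichotomy[of a b B] z assms(4)[of a] assms(3)
      unfolding ab by (intro gapsI) (auto intro: order_trans)
  qed
  ultimately show "gaps (A \<union> B) = gaps A \<union> gaps B" by blast
  have False if "(a, b) \<in> gaps A" "(a, b) \<in> gaps B" for a b
    using gapsD[OF that(1)] gapsD[OF that(2)] assms(3)[of b] assms(4)[of a] by auto
  then show "gaps A \<inter> gaps B = {}" by auto
qed

lemma gaps_affine:
  assumes "k > 0"
  shows "gaps ((\<lambda>x. d + k * x) ` A) = (\<lambda>(a, b). (d + k * a, d + k * b)) ` gaps A"
proof -
  have iff: "(d + k * a, d + k * b) \<in> gaps ((\<lambda>x. d + k * x) ` A) \<longleftrightarrow> (a, b) \<in> gaps A" for a b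
  proof -
    have "d + k * x \<in> (\<lambda>x. d + k * x) ` A \<longleftrightarrow> x \<in> A" for x
      using assms by (auto simp: image_iff)
    moreover have "{d + k * a<..<d + k * b} \<inter> (\<lambda>x. d + k * x) ` A = (\<lambda>x. d + k * x) ` ({a<..<b} \<inter> A)"
      using assms by auto
    ultimately show ?thesis
      using assms by (simp add: gaps_def)
  qed
  show ?thesis
  proof (intro equalityI subsetI)
    fix z assume z: "z \<in> gaps ((\<lambda>x. d + k * x) ` A)"
    then obtain a b where "z = (d + k * a, d + k * b)"
      using gapsD by (metis (no_types, lifting) imageE surj_pair)
    then show "z \<in> (\<lambda>(a, b). (d + k * a, d + k * b)) ` gaps A"
      using z iff by (auto intro!: image_eqI[of _ _ "(a, b)"])
  qed (use iff in auto)
qed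

text \<open>Suitable choices of \<open>f\<close> give the number of gaps, the second moment of their
  lengths, and the total length of the short or of the long gaps.\<close>

definition gap_sum :: "real set \<Rightarrow> (real \<Rightarrow> real) \<Rightarrow> real" where
  "gap_sum P f = (\<Sum>(a, b)\<in>gaps P. f (b - a))"

lemma gap_sum_Un:
  assumes "finite A" "finite B" "m \<in> A" "m \<in> B"
    "\<And>x. x \<in> A \<Longrightarrow> x \<le> m" "\<And>x. x \<in> B \<Longrightarrow> m \<le> x"
  shows "gap_sum (A \<union> B) f = gap_sum A f + gap_sum B f"
proof -
  have "gaps (A \<union> B) = gaps A \<union> gaps B" "gaps A \<inter> gaps B = {}"
    by (rule gaps_Un[of m]; fact assms)+
  then show ?thesis
    unfolding gap_sum_def using assms(1,2) by (simp add: sum.union_disjoint finite_gaps)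
qed

lemma gap_sum_affine:
  assumes "k > 0"
  shows "gap_sum ((\<lambda>x. d + k * x) ` A) f = gap_sum A (\<lambda>x. f (k * x))"
proof -
  have "inj_on (\<lambda>(a, b). (d + k * a, d + k * b)) (gaps A)"
    using assms by (auto simp: inj_on_def)
  then show ?thesis
    unfolding gap_sum_def gaps_affine[OF assms]
    by (simp add: sum.reindex case_prod_unfold right_diff_distrib)
qed

lemma gap_sum_filter:
  assumes "finite P"
  shows "gap_sum P (\<lambda>x. if R x then f x else 0) = (\<Sum>(a, b)\<in>{(a, b) \<in> gaps P. R (b - a)}. f (b - a))"
  unfolding gap_sum_def using finite_gaps[OF assms]
  by (intro sum.mono_neutral_cong_right) (auto split: if_splits)

subsection \<open>Stopping cubes\<close>

text \<open>\<open>E\<close> is tied to \<open>P\<close> on the half-open cube only. The point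
  \<open>M\<close> lies outside the cube but is kept in \<open>P\<close> as the right end of the
  last gap.\<close>

locale stopping_cubes =
  fixes M :: real and P E :: "real set"
  assumes M_pos: "0 < M"
    and finite_P: "finite P"
    and zero_in: "0 \<in> P"
    and M_in: "M \<in> P"
    and P_sub: "P \<subseteq> {0..M}"
    and closure_E: "closure E \<inter> {0..<M} = P \<inter> {0..<M}"
begin

section \<open>Geometry of the dyadic grid\<close>

definition cube :: "nat \<Rightarrow> nat \<Rightarrow> real set" where
  "cube j k = {real k * (M / 2 ^ j) ..< real k * (M / 2 ^ j) + M / 2 ^ j}"

lemma is_cube_Q0: "is_cube {0..<M}"
  using M_pos by (auto simp: is_cube_def)

lemma dyadic_gen_eq: "dyadic_gen j {0..<M} = cube j ` {..<2 ^ j}"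
proof -
  have "cube j k = {real k * (M / 2 ^ j) ..< real (Suc k) * (M / 2 ^ j)}" for k
    unfolding cube_def of_nat_Suc distrib_right by (simp add: add.commute)
  then show ?thesis
    using M_pos by (auto simp: dyadic_gen_def side_length_cube)
qed

text \<open>Writing membership as a floor equation reduces uniqueness of the index and nesting to
  integer arithmetic.\<close>

lemma mem_cube: "x \<in> cube j k \<longleftrightarrow> \<lfloor>x * 2 ^ j / M\<rfloor> = int k"
  using M_pos by (auto simp: cube_def floor_eq_iff field_simps)

lemma cube_inject: "x \<in> cube j k \<Longrightarrow> x \<in> cube j l \<Longrightarrow> k = l"
  by (simp add: mem_cube)

lemma cube_nonempty: "real k * (M / 2 ^ j) \<in> cube j k"
  using M_pos by (simp add: cube_def)

lemma side_length_cube_eq: "side_length (cube j k) = M / 2 ^ j"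
  using M_pos by (simp add: cube_def side_length_def)

lemma cube_dist: "x \<in> cube j k \<Longrightarrow> y \<in> cube j k \<Longrightarrow> \<bar>x - y\<bar> < M / 2 ^ j"
  unfolding cube_def atLeastLessThan_iff abs_less_iff by linarith

lemma cube_subset_Q0: "k < 2 ^ j \<Longrightarrow> cube j k \<subseteq> {0..<M}"
  using dyadic_gen_partition(1)[OF is_cube_Q0, of j] by (auto simp: dyadic_gen_eq)

text \<open>The floor of \<open>y\<close> is the floor of \<open>2 * y\<close> divided by 2 in the
  integers, so halving the index passes to the parent.\<close>

lemma cube_subset_half: "cube (Suc j) k \<subseteq> cube j (k div 2)"
proof
  fix x assume x: "x \<in> cube (Suc j) k"
  define y where "y = x * 2 ^ j / M"
  have "\<lfloor>2 * y\<rfloor> = int k" using x by (simp add: mem_cube y_def mult_ac)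
  then have "real k \<le> 2 * y" "2 * y < real k + 1" by (simp_all add: floor_eq_iff)
  moreover have "k = 2 * (k div 2) + k mod 2" "k mod 2 < 2" by simp_all
  then have "2 * real (k div 2) \<le> real k" "real k \<le> 2 * real (k div 2) + 1" by linarith+
  ultimately have "real (k div 2) \<le> y" "y < real (k div 2) + 1"
    using \<open>\<lfloor>2 * y\<rfloor> = int k\<close> by linarith+
  then show "x \<in> cube j (k div 2)"
    unfolding mem_cube y_def[symmetric] by (simp add: floor_eq_iff)
qed

lemma cube_nested:
  assumes "i \<le> j" "x \<in> cube j k" "x \<in> cube i l"
  shows "cube j k \<subseteq> cube i l"
  using assms
proof (induction j arbitrary: k rule: dec_induct)
  case base
  then show ?case using cube_inject by blast
next
  case (step j)
  then show ?case using cube_subset_half by (meson order_trans subsetD)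
qed

text \<open>For the uniqueness behind \<open>THE\<close>, the side length determines the generation,
  and a common point then determines the index.\<close>

lemma dyadic_parent_cube:
  assumes k: "k < 2 ^ Suc j"
  shows "dyadic_parent {0..<M} (cube (Suc j) k) = cube j (k div 2)"
  unfolding dyadic_parent_def
proof (rule the_equality)
  have "k div 2 < 2 ^ j" using k by auto
  then show "\<exists>i. cube (Suc j) k \<in> dyadic_gen (Suc i) {0..<M} \<and>
      cube j (k div 2) \<in> dyadic_gen i {0..<M} \<and> cube (Suc j) k \<subseteq> cube j (k div 2)"
    using k cube_subset_half unfolding dyadic_gen_eq by blast
next
  fix R assume "\<exists>i. cube (Suc j) k \<in> dyadic_gen (Suc i) {0..<M} \<and>
      R \<in> dyadic_gen i {0..<M} \<and> cube (Suc j) k \<subseteq> R"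
  then obtain i l m where R: "cube (Suc j) k = cube (Suc i) m" "R = cube i l" "cube (Suc j) k \<subseteq> R"
    unfolding dyadic_gen_eq by blast
  from R(1) have "M / 2 ^ Suc j = M / 2 ^ Suc i" by (metis side_length_cube_eq)
  then have "i = j" using M_pos by (simp add: field_simps)
  moreover obtain x where "x \<in> cube (Suc j) k" using cube_nonempty by blast
  ultimately show "R = cube j (k div 2)"
    using R cube_subset_half cube_inject by (metis subsetD)
qed

section \<open>The family of stopping cubes\<close>

definition free :: "real set set" where
  "free = dyadic_free E {0..<M}"

text \<open>All cubes involved lie in \<open>{0..<M}\<close>, where \<open>closure E\<close> and
  \<open>P\<close> agree. Starting at generation \<open>Suc j\<close> is the same as removing the
  root, since deeper cubes are strictly shorter.\<close>

lemma free_iff: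
  "Q \<in> free \<longleftrightarrow> (\<exists>j k. k < 2 ^ Suc j \<and> Q = cube (Suc j) k \<and> Q \<inter> P = {} \<and>
     cube j (k div 2) \<inter> P \<noteq> {})" (is "_ \<longleftrightarrow> ?R")
proof -
  have clP: "cube j k \<inter> closure E = cube j k \<inter> P" if "k < 2 ^ j" for j k
    using cube_subset_Q0[OF that] closure_E by blast
  have half: "k div 2 < 2 ^ j" if "k < 2 ^ Suc j" for j k :: nat
    using that by auto
  have neq: "cube (Suc j) k \<noteq> {0..<M}" for j k
  proof
    assume "cube (Suc j) k = {0..<M}"
    then have "M / 2 ^ Suc j = M" using M_pos by (metis side_length_cube_eq side_length_cube diff_zero)
    moreover have "(1::real) < 2 ^ Suc j" by (rule one_less_power) auto
    then have "M / 2 ^ Suc j < M" using M_pos by (simp add: divide_less_eq)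
    ultimately show False by simp
  qed
  have dyadic: "Q \<in> dyadic {0..<M} - {{0..<M}} \<longleftrightarrow> (\<exists>j k. k < 2 ^ Suc j \<and> Q = cube (Suc j) k)"
  proof
    assume "Q \<in> dyadic {0..<M} - {{0..<M}}"
    then obtain j k where jk: "k < 2 ^ j" "Q = cube j k" "Q \<noteq> {0..<M}"
      by (auto simp: dyadic_def dyadic_gen_eq)
    then have "j \<noteq> 0" by (auto simp: cube_def)
    with jk show "\<exists>j k. k < 2 ^ Suc j \<and> Q = cube (Suc j) k" by (metis not0_implies_Suc)
  next
    assume "\<exists>j k. k < 2 ^ Suc j \<and> Q = cube (Suc j) k"
    then show "Q \<in> dyadic {0..<M} - {{0..<M}}"
      using neq unfolding dyadic_def dyadic_gen_eq by blast
  qed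
  have meets: "cube (Suc j) k \<inter> closure E = {} \<and>
      dyadic_parent {0..<M} (cube (Suc j) k) \<inter> closure E \<noteq> {} \<longleftrightarrow>
      cube (Suc j) k \<inter> P = {} \<and> cube j (k div 2) \<inter> P \<noteq> {}" if "k < 2 ^ Suc j" for j k
    by (simp only: clP[OF that] dyadic_parent_cube[OF that] clP[OF half[OF that]])
  show ?thesis
  proof
    assume "Q \<in> free"
    then have Q: "Q \<in> dyadic {0..<M} - {{0..<M}}"
      "Q \<inter> closure E = {} \<and> dyadic_parent {0..<M} Q \<inter> closure E \<noteq> {}"
      by (simp_all add: free_def dyadic_free_def)
    then obtain j k where jk: "k < 2 ^ Suc j" "Q = cube (Suc j) k"
      unfolding dyadic by blast
    show ?R
      using jk Q(2)[unfolded jk(2) meets[OF jk(1)]] by blast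
  next
    assume ?R
    then obtain j k where jk: "k < 2 ^ Suc j" "Q = cube (Suc j) k"
      "cube (Suc j) k \<inter> P = {} \<and> cube j (k div 2) \<inter> P \<noteq> {}" by blast
    show "Q \<in> free"
      unfolding free_def dyadic_free_def mem_Collect_eq dyadic
      using jk(1,2) jk(3)[folded meets[OF jk(1)]] by blast
  qed
qed

lemma sets_free: "Q \<in> free \<Longrightarrow> Q \<in> sets lebesgue"
  by (auto simp: free_iff cube_def)

lemma countable_free: "countable free"
proof (rule countable_subset)
  show "free \<subseteq> range (\<lambda>(j, k). cube j k)" by (force simp: free_iff)
qed simp

text \<open>If two distinct stopping cubes overlapped, the parent of the smaller one would be
  contained in the larger one. But the parent meets \<open>P\<close> and the larger cube does
  not.\<close>

lemma disjoint_free: "disjoint free"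
proof -
  have "R = Q" if R: "k < 2 ^ Suc i" "R = cube (Suc i) k" "R \<inter> P = {}"
    and Q: "Q = cube (Suc j) l" "cube j (l div 2) \<inter> P \<noteq> {}"
    and x: "x \<in> R" "x \<in> Q" and ij: "i \<le> j" for i j k l x Q R
  proof (cases "i = j")
    case True
    then show ?thesis using R Q x cube_inject by blast
  next
    case False
    then have "cube j (l div 2) \<subseteq> cube (Suc i) k"
      using x R Q ij cube_subset_half by (intro cube_nested[of _ _ x]) auto
    then show ?thesis using R Q by blast
  qed
  note eq = this
  show ?thesis
    unfolding disjoint_def
  proof (intro ballI impI, rule ccontr)
    fix R Q assume RQ: "R \<in> free" "Q \<in> free" "R \<noteq> Q" "R \<inter> Q \<noteq> {}"
    then obtain x where x: "x \<in> R" "x \<in> Q" by blast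
    obtain i k where R: "k < 2 ^ Suc i" "R = cube (Suc i) k" "R \<inter> P = {}" "cube i (k div 2) \<inter> P \<noteq> {}"
      using RQ(1) unfolding free_iff by blast
    obtain j l where Q: "l < 2 ^ Suc j" "Q = cube (Suc j) l" "Q \<inter> P = {}" "cube j (l div 2) \<inter> P \<noteq> {}"
      using RQ(2) unfolding free_iff by blast
    show False
      using eq[OF R(1-3) Q(2,4) x] eq[OF Q(1-3) R(2,4) x(2,1)] RQ(3) by (metis nat_le_linear)
  qed
qed

text \<open>A point off the finite set \<open>P\<close> has positive distance to it, so small enough
  cubes around the point miss \<open>P\<close>. The first generation that does so gives a stopping
  cube; it is not the root because \<open>0 \<in> P\<close>.\<close>

lemma Union_free: "\<Union>free = {0..<M} - P"
proof (intro equalityI subsetI)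
  fix x assume "x \<in> \<Union>free"
  then obtain Q where Q: "Q \<in> free" "x \<in> Q" by blast
  then obtain j k where "k < 2 ^ Suc j" "Q = cube (Suc j) k" "Q \<inter> P = {}"
    unfolding free_iff by blast
  with Q(2) show "x \<in> {0..<M} - P" using cube_subset_Q0 by blast
next
  fix x assume x: "x \<in> {0..<M} - P"
  obtain e where e: "e > 0" "\<And>p. p \<in> P \<Longrightarrow> e \<le> dist x p"
    using finite_set_avoid[OF finite_P, of x] x by (metis DiffD2)
  define idx where "idx j = nat \<lfloor>x * 2 ^ j / M\<rfloor>" for j :: nat
  have in_idx: "x \<in> cube j (idx j)" for j
    using x M_pos by (simp add: mem_cube idx_def)
  obtain j where "(1 / 2) ^ j < e / M"
    using real_arch_pow_inv[of "e / M" "1 / 2"] e(1) M_pos by auto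
  then have j: "M / 2 ^ j < e" using M_pos by (simp add: field_simps power_divide)
  have "cube j (idx j) \<inter> P = {}"
  proof (rule ccontr)
    assume "cube j (idx j) \<inter> P \<noteq> {}"
    then obtain p where "p \<in> cube j (idx j)" "p \<in> P" by blast
    then show False
      using cube_dist[OF in_idx, of p j] e(2)[of p] j by (simp add: dist_real_def)
  qed
  define i where "i = (LEAST j. cube j (idx j) \<inter> P = {})"
  have i: "cube i (idx i) \<inter> P = {}"
    unfolding i_def by (rule LeastI) fact
  have "idx 0 = 0" using x M_pos by (simp add: idx_def floor_eq_iff)
  then have "cube 0 (idx 0) \<inter> P \<noteq> {}" using zero_in M_pos by (auto simp: cube_def)
  with i obtain n where n: "i = Suc n" by (metis not0_implies_Suc)
  have "\<not> cube n (idx n) \<inter> P = {}"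
    by (rule not_less_Least) (simp add: n flip: i_def)
  moreover have "idx i div 2 = idx n"
    using cube_subset_half in_idx cube_inject unfolding n by blast
  moreover have "idx i < 2 ^ i"
    using x M_pos by (simp add: idx_def nat_less_iff floor_less_iff field_simps)
  ultimately have "cube i (idx i) \<in> free"
    unfolding free_iff n using i n by (intro exI[of _ n] exI[of _ "idx (Suc n)"]) simp
  then show "x \<in> \<Union>free" using in_idx by blast
qed

text \<open>An interval that misses \<open>P\<close> cannot pass the right end of the gap containing
  its left end point.\<close>

lemma free_in_gap:
  assumes "Q \<in> free"
  obtains a b where "(a, b) \<in> gaps P" "Q \<subseteq> {a<..<b}" "side_length Q \<le> b - a"
proof -
  obtain j k where jk: "k < 2 ^ Suc j" "Q = cube (Suc j) k" "Q \<inter> P = {}"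
    using assms by (auto simp: free_iff)
  define u w where "u = real k * (M / 2 ^ Suc j)" and "w = u + M / 2 ^ Suc j"
  have Q: "Q = {u..<w}" "u \<in> Q" "side_length Q = w - u"
    unfolding jk(2) side_length_cube_eq using M_pos by (simp_all add: cube_def u_def w_def)
  have "u \<in> {0..<M}" using Q jk cube_subset_Q0 by blast
  moreover have "u \<notin> P" using Q jk by blast
  ultimately obtain a b where ab: "(a, b) \<in> gaps P" "a < u" "u < b"
    using gap_around[OF finite_P zero_in M_in, of u] by auto
  then have "b \<notin> Q" using jk by (auto simp: gaps_def)
  then have "w \<le> b" using ab Q by auto
  then show ?thesis using ab Q by (intro that[of a b]) auto
qed

text \<open>The parent of \<open>Q\<close> has length at most \<open>2 * L\<close> and contains both
  \<open>x\<close> and a point of \<open>P\<close>. That point lies outside the gap, so an end point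
  of the gap is at least as close to \<open>x\<close>.\<close>

lemma free_near_gap_end:
  assumes "Q \<in> free" "side_length Q \<le> L" "x \<in> Q" "(a, b) \<in> gaps P" "x \<in> {a<..<b}"
  shows "x < a + 2 * L \<or> b - 2 * L < x"
proof -
  obtain j k p where jk: "Q = cube (Suc j) k" and p: "p \<in> cube j (k div 2)" "p \<in> P"
    using assms(1) by (auto simp: free_iff)
  have "\<bar>x - p\<bar> < M / 2 ^ j"
    using p assms(3) jk cube_subset_half by (intro cube_dist[of _ j "k div 2"]) auto
  moreover have "M / 2 ^ j \<le> 2 * L"
    using assms(2) by (simp add: jk side_length_cube_eq)
  moreover have "p \<le> a \<or> b \<le> p" using p assms(4) by (force simp: gaps_def)
  ultimately show ?thesis using assms(5) by auto
qed

section \<open>Measures of the unions of short and of long stopping cubes\<close>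

definition small_part :: "real \<Rightarrow> real set" where
  "small_part L = \<Union>{Q \<in> free. side_length Q \<le> L}"

definition large_part :: "real \<Rightarrow> real set" where
  "large_part L = \<Union>{Q \<in> free. L \<le> side_length Q}"

lemma fmeasurable_free_Union:
  assumes "F \<subseteq> free"
  shows "\<Union>F \<in> fmeasurable lebesgue"
proof -
  have "F \<subseteq> sets lebesgue" using assms sets_free by blast
  moreover have "countable F" using assms countable_free by (rule countable_subset)
  ultimately have "\<Union>F \<in> sets lebesgue" by (intro sets.countable_Union)
  moreover have "\<Union>F \<subseteq> {0..<M} - P"
    unfolding Union_free[symmetric] using assms by (rule Union_mono)
  then have "\<Union>F \<subseteq> cbox 0 M" by (rule order_trans) auto
  moreover have "cbox 0 M \<in> fmeasurable lebesgue" by (rule lmeasurable_cbox)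
  ultimately show ?thesis using fmeasurableI2 by blast
qed

text \<open>This converts the infinite sums in the definitions of both scales into measures of
  unions.\<close>

lemma infsum_free:
  assumes "F \<subseteq> free"
  shows "(\<Sum>\<^sub>\<infinity>Q\<in>F. measure lebesgue Q / measure lebesgue {0..<M}) = measure lebesgue (\<Union>F) / M"
proof -
  have "(measure lebesgue has_sum measure lebesgue (\<Union>F)) F"
  proof (rule has_sum_measure_Union)
    show "countable F" using countable_subset[OF assms countable_free] .
    show "disjoint F" using assms disjoint_free by (rule pairwise_subset[rotated])
    show "F \<subseteq> sets lebesgue" using assms sets_free by blast
    show "\<Union>F \<in> fmeasurable lebesgue" using assms by (rule fmeasurable_free_Union)
  qed
  then have "((\<lambda>Q. measure lebesgue Q / M) has_sum measure lebesgue (\<Union>F) / M) F"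
    by (rule has_sum_divide_const)
  then show ?thesis using M_pos by (simp add: infsumI)
qed

lemma fmeasurable_parts [simp]:
  "small_part L \<in> fmeasurable lebesgue" "large_part L \<in> fmeasurable lebesgue"
  unfolding small_part_def large_part_def by (rule fmeasurable_free_Union, blast)+

lemma parts_subset: "small_part L \<subseteq> {0..<M} - P" "large_part L \<subseteq> {0..<M} - P"
  using Union_free by (auto simp: small_part_def large_part_def)

lemma parts_cover: "x \<in> {0..<M} - P \<Longrightarrow> x \<in> small_part L \<or> x \<in> large_part L"
  unfolding small_part_def large_part_def Union_free[symmetric] using linear by blast

lemma finite_gaps_P: "finite (gaps P)"
  using finite_P by (rule finite_gaps)

lemma gap_subset: "(a, b) \<in> gaps P \<Longrightarrow> {a<..<b} \<subseteq> {0..<M} - P"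
proof
  fix x assume g: "(a, b) \<in> gaps P" and x: "x \<in> {a<..<b}"
  have "a \<in> {0..M}" "b \<in> {0..M}" using gapsD[OF g] P_sub by auto
  moreover have "x \<notin> P" using g x by (auto simp: gaps_def)
  ultimately show "x \<in> {0..<M} - P" using x by auto
qed

text \<open>Short cubes occupy only the two margins of width \<open>2 * L\<close> at the ends of a
  gap.\<close>

lemma measure_small_part_gap:
  assumes "(a, b) \<in> gaps P" "0 \<le> L"
  shows "measure lebesgue (small_part L \<inter> {a<..<b}) \<le> 4 * L"
proof -
  have "small_part L \<inter> {a<..<b} \<subseteq> {a<..<a + 2 * L} \<union> {b - 2 * L<..<b}"
  proof
    fix x assume x: "x \<in> small_part L \<inter> {a<..<b}"
    then obtain Q where "Q \<in> free" "side_length Q \<le> L" "x \<in> Q" by (auto simp: small_part_def)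
    then show "x \<in> {a<..<a + 2 * L} \<union> {b - 2 * L<..<b}"
      using free_near_gap_end[OF _ _ _ assms(1)] x by auto
  qed
  then have "measure lebesgue (small_part L \<inter> {a<..<b}) \<le>
      measure lebesgue ({a<..<a + 2 * L} \<union> {b - 2 * L<..<b})"
    by (intro measure_mono_fmeasurable) (auto intro!: sets.Int fmeasurable.Un simp: fmeasurableD)
  also have "\<dots> \<le> measure lebesgue {a<..<a + 2 * L} + measure lebesgue {b - 2 * L<..<b}"
    by (rule measure_Un_le) auto
  also have "\<dots> = 4 * L" using assms(2) by simp
  finally show ?thesis .
qed

text \<open>\<open>X\<close> is \<open>UNIV\<close> when whole gaps are added up, and one of the two
  parts when only its share of each gap counts.\<close>

lemma measure_Union_gaps:
  assumes "G \<subseteq> gaps P" "\<And>g. g \<in> G \<Longrightarrow> X \<inter> {fst g<..<snd g} \<in> fmeasurable lebesgue"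
  shows "measure lebesgue (\<Union>g\<in>G. X \<inter> {fst g<..<snd g}) = (\<Sum>g\<in>G. measure lebesgue (X \<inter> {fst g<..<snd g}))"
proof (rule measure_UNION')
  show "finite G" using assms(1) finite_gaps_P finite_subset by blast
  show "pairwise (\<lambda>g h. disjnt (X \<inter> {fst g<..<snd g}) (X \<inter> {fst h<..<snd h})) G"
    unfolding pairwise_def disjnt_def
  proof (intro ballI impI)
    fix g h assume gh: "g \<in> G" "h \<in> G" "g \<noteq> h"
    show "X \<inter> {fst g<..<snd g} \<inter> (X \<inter> {fst h<..<snd h}) = {}"
    proof (rule ccontr)
      assume "\<not> ?thesis"
      then obtain x where x: "x \<in> {fst g<..<snd g}" "x \<in> {fst h<..<snd h}" by blast
      have "(fst g, snd g) \<in> gaps P" "(fst h, snd h) \<in> gaps P" using gh assms(1) by auto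
      from gap_unique[OF this x] gh(3) show False by (simp add: prod_eq_iff)
    qed
  qed
qed (use assms in auto)

text \<open>The margin bound summed over all gaps; evaluated at the small scale it bounds that scale
  from below.\<close>

lemma measure_small_part_le:
  assumes "0 \<le> L"
  shows "measure lebesgue (small_part L) \<le> 4 * L * card (gaps P)"
proof -
  have "small_part L \<subseteq> (\<Union>g\<in>gaps P. small_part L \<inter> {fst g<..<snd g})"
  proof
    fix x assume x: "x \<in> small_part L"
    then have "x \<in> {0..<M} - P" using parts_subset by blast
    then obtain a b where "(a, b) \<in> gaps P" "a < x" "x < b"
      using gap_around[OF finite_P zero_in M_in, of x] by auto
    then show "x \<in> (\<Union>g\<in>gaps P. small_part L \<inter> {fst g<..<snd g})"
      using x by (intro UN_I[of "(a, b)"]) auto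
  qed
  then have "measure lebesgue (small_part L) \<le> measure lebesgue (\<Union>g\<in>gaps P. small_part L \<inter> {fst g<..<snd g})"
    by (intro measure_mono_fmeasurable fmeasurable.finite_UN fmeasurable_Int_fmeasurable finite_gaps_P)
      (auto simp: fmeasurableD)
  also have "\<dots> = (\<Sum>g\<in>gaps P. measure lebesgue (small_part L \<inter> {fst g<..<snd g}))"
    by (rule measure_Union_gaps) (auto intro: fmeasurable_Int_fmeasurable)
  also have "\<dots> \<le> (\<Sum>g\<in>gaps P. 4 * L)"
    using assms by (intro sum_mono measure_small_part_gap) auto
  finally show ?thesis by (simp add: mult_ac)
qed

text \<open>A gap of length at most \<open>L\<close> is filled by stopping cubes inside it, and
  these are no longer than the gap.\<close>

lemma measure_small_part_ge:
  "gap_sum P (\<lambda>x. if x \<le> L then x else 0) \<le> measure lebesgue (small_part L)"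
proof -
  let ?G = "{(a, b) \<in> gaps P. b - a \<le> L}"
  have "gap_sum P (\<lambda>x. if x \<le> L then x else 0) = (\<Sum>(a, b)\<in>?G. b - a)"
    using gap_sum_filter[OF finite_P, of "\<lambda>x. x \<le> L" "\<lambda>x. x"] by simp
  also have "\<dots> = (\<Sum>g\<in>?G. measure lebesgue (UNIV \<inter> {fst g<..<snd g}))"
    by (intro sum.cong) (auto simp: gaps_def)
  also have "\<dots> = measure lebesgue (\<Union>g\<in>?G. UNIV \<inter> {fst g<..<snd g})"
    by (rule measure_Union_gaps[symmetric]) auto
  also have "\<dots> \<le> measure lebesgue (small_part L)"
  proof (rule measure_mono_fmeasurable)
    show "(\<Union>g\<in>?G. UNIV \<inter> {fst g<..<snd g}) \<subseteq> small_part L"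
    proof clarsimp
      fix a b x assume g: "(a, b) \<in> gaps P" "b - a \<le> L" "a < x" "x < b"
      then have "x \<in> {0..<M} - P" using gap_subset[of a b] by auto
      then obtain Q where Q: "Q \<in> free" "x \<in> Q" using Union_free by blast
      obtain a' b' where "(a', b') \<in> gaps P" "Q \<subseteq> {a'<..<b'}" "side_length Q \<le> b' - a'"
        using free_in_gap[OF Q(1)] .
      with g Q have "side_length Q \<le> L" using gap_unique[of a b P a' b' x] by auto
      with Q show "x \<in> small_part L" by (auto simp: small_part_def)
    qed
    have "finite ?G" using finite_gaps_P by (rule rev_finite_subset) auto
    then show "(\<Union>g\<in>?G. UNIV \<inter> {fst g<..<snd g}) \<in> sets lebesgue" by (intro sets.finite_UN) auto
  qed simp
  finally show ?thesis .
qed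

text \<open>Markov's inequality: cubes of length at least \<open>L\<close> lie in gaps of some
  length \<open>x\<close> with \<open>L \<le> x\<close>, and there
  \<open>x * L \<le> x\<^sup>2\<close>.\<close>

lemma measure_large_part_le:
  "measure lebesgue (large_part L) * L \<le> gap_sum P (\<lambda>x. x\<^sup>2)"
proof -
  let ?G = "{(a, b) \<in> gaps P. L \<le> b - a}"
  have fin: "finite ?G" using finite_gaps_P by (rule rev_finite_subset) auto
  have nn: "0 \<le> gap_sum P (\<lambda>x. x\<^sup>2)" unfolding gap_sum_def by (intro sum_nonneg) auto
  have "large_part L \<subseteq> (\<Union>g\<in>?G. {fst g<..<snd g})"
  proof
    fix x assume "x \<in> large_part L"
    then obtain Q where Q: "Q \<in> free" "L \<le> side_length Q" "x \<in> Q" by (auto simp: large_part_def)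
    obtain a b where "(a, b) \<in> gaps P" "Q \<subseteq> {a<..<b}" "side_length Q \<le> b - a"
      using free_in_gap[OF Q(1)] .
    with Q show "x \<in> (\<Union>g\<in>?G. {fst g<..<snd g})" by (intro UN_I[of "(a, b)"]) auto
  qed
  then have "measure lebesgue (large_part L) \<le> measure lebesgue (\<Union>g\<in>?G. {fst g<..<snd g})"
    using fin by (intro measure_mono_fmeasurable fmeasurable.finite_UN) (simp_all add: fmeasurableD)
  also have "\<dots> \<le> (\<Sum>g\<in>?G. measure lebesgue {fst g<..<snd g})"
    using fin by (intro measure_UNION_le) auto
  also have "\<dots> = (\<Sum>(a, b)\<in>?G. b - a)"
    by (intro sum.cong) (auto simp: gaps_def)
  finally have le: "measure lebesgue (large_part L) \<le> (\<Sum>(a, b)\<in>?G. b - a)" .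
  show ?thesis
  proof (cases "0 \<le> L")
    case True
    have "measure lebesgue (large_part L) * L \<le> (\<Sum>(a, b)\<in>?G. b - a) * L"
      using le True by (rule mult_right_mono)
    also have "\<dots> = (\<Sum>(a, b)\<in>?G. (b - a) * L)"
      by (simp add: sum_distrib_right case_prod_unfold)
    also have "\<dots> \<le> (\<Sum>(a, b)\<in>?G. (b - a)\<^sup>2)"
      unfolding power2_eq_square by (rule sum_mono) (clarsimp, intro mult_left_mono, auto dest: gapsD)
    also have "\<dots> \<le> gap_sum P (\<lambda>x. x\<^sup>2)"
      unfolding gap_sum_def by (rule sum_mono2[OF finite_gaps_P]) auto
    finally show ?thesis .
  next
    case False
    then have "measure lebesgue (large_part L) * L \<le> 0"
      by (intro mult_nonneg_nonpos) auto
    then show ?thesis using nn by linarith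
  qed
qed

text \<open>Cubes of length at most \<open>r / 8\<close> cover at most
  \<open>4 * (r / 8) = r / 2\<close> of a gap. In a gap of length at least \<open>r\<close>, at
  least half is therefore left to longer cubes.\<close>

lemma measure_large_part_ge:
  assumes "0 \<le> r"
  shows "gap_sum P (\<lambda>x. if r \<le> x then x else 0) / 2 \<le> measure lebesgue (large_part (r / 8))"
proof -
  let ?G = "{(a, b) \<in> gaps P. r \<le> b - a}"
  let ?S = "small_part (r / 8)" and ?L = "large_part (r / 8)"
  have fin: "finite ?G" using finite_gaps_P by (rule rev_finite_subset) auto
  have fm: "?L \<inter> {fst g<..<snd g} \<in> fmeasurable lebesgue" "?S \<inter> {fst g<..<snd g} \<in> fmeasurable lebesgue" for g
    by (auto intro: fmeasurable_Int_fmeasurable)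
  have gap: "(b - a) / 2 \<le> measure lebesgue (?L \<inter> {a<..<b})" if g: "(a, b) \<in> gaps P" "r \<le> b - a" for a b
  proof -
    have "{a<..<b} \<subseteq> (?L \<inter> {a<..<b}) \<union> (?S \<inter> {a<..<b})"
      using gap_subset[OF g(1)] parts_cover by blast
    then have "measure lebesgue {a<..<b} \<le> measure lebesgue ((?L \<inter> {a<..<b}) \<union> (?S \<inter> {a<..<b}))"
      using fm[of "(a, b)"] by (intro measure_mono_fmeasurable) auto
    also have "\<dots> \<le> measure lebesgue (?L \<inter> {a<..<b}) + measure lebesgue (?S \<inter> {a<..<b})"
      using fm[of "(a, b)"] by (intro measure_Un_le) auto
    also have "\<dots> \<le> measure lebesgue (?L \<inter> {a<..<b}) + 4 * (r / 8)"
      using measure_small_part_gap[OF g(1), of "r / 8"] assms by simp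
    finally show ?thesis using g(2) gapsD[OF g(1)] by simp
  qed
  have "gap_sum P (\<lambda>x. if r \<le> x then x else 0) / 2 = (\<Sum>(a, b)\<in>?G. (b - a) / 2)"
    using gap_sum_filter[OF finite_P, of "\<lambda>x. r \<le> x" "\<lambda>x. x"]
    by (simp add: sum_divide_distrib case_prod_unfold)
  also have "\<dots> \<le> (\<Sum>g\<in>?G. measure lebesgue (?L \<inter> {fst g<..<snd g}))"
    by (intro sum_mono) (use gap in auto)
  also have "\<dots> = measure lebesgue (\<Union>g\<in>?G. ?L \<inter> {fst g<..<snd g})"
    using fm by (intro measure_Union_gaps[symmetric]) auto
  also have "\<dots> \<le> measure lebesgue ?L"
    using fin fm by (intro measure_mono_fmeasurable) (auto simp: fmeasurableD intro!: sets.finite_UN)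
  finally show ?thesis .
qed

lemma measure_parts: "M \<le> measure lebesgue (small_part L) + measure lebesgue (large_part L)"
proof -
  have P: "P \<in> fmeasurable lebesgue"
    using finite_P by (simp add: negligible_finite negligible_imp_measurable)
  have "M = measure lebesgue {0..<M}" using M_pos by simp
  also have "\<dots> \<le> measure lebesgue ((small_part L \<union> large_part L) \<union> P)"
  proof (rule measure_mono_fmeasurable)
    show "{0..<M} \<subseteq> (small_part L \<union> large_part L) \<union> P" using parts_cover by blast
    show "(small_part L \<union> large_part L) \<union> P \<in> fmeasurable lebesgue" using P by (intro fmeasurable.Un) auto
  qed simp
  also have "\<dots> \<le> measure lebesgue (small_part L \<union> large_part L) + measure lebesgue P"
    using P by (intro measure_Un_le) (auto simp: fmeasurableD)
  also have "measure lebesgue P = 0"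
    using finite_P by (simp add: negligible_finite negligible_imp_measure0)
  also have "measure lebesgue (small_part L \<union> large_part L) \<le>
      measure lebesgue (small_part L) + measure lebesgue (large_part L)"
    by (intro measure_Un_le) (auto simp: fmeasurableD)
  finally show ?thesis by simp
qed

section \<open>Attainment of the maximum and the minimum that define the scales\<close>

lemma side_length_free:
  assumes "Q \<in> free"
  obtains i where "side_length Q = M / 2 ^ Suc i"
proof -
  obtain j k where "Q = cube (Suc j) k" using assms unfolding free_iff by blast
  then show ?thesis using that side_length_cube_eq by blast
qed

lemma scale_less_iff: "M / 2 ^ i < M / 2 ^ j \<longleftrightarrow> j < i"
proof -
  have "M / 2 ^ i < M / 2 ^ j \<longleftrightarrow> (2::real) ^ j < 2 ^ i"
    using M_pos by (simp add: field_simps)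
  then show ?thesis by simp
qed

lemma side_length_free_less:
  assumes "Q \<in> free"
  shows "side_length Q < M"
proof -
  obtain i where "side_length Q = M / 2 ^ Suc i" using side_length_free[OF assms] .
  then show ?thesis using scale_less_iff[of "Suc i" 0] by simp
qed

lemma large_part_empty:
  assumes "M \<le> L"
  shows "large_part L = {}"
proof -
  have "\<not> L \<le> side_length Q" if "Q \<in> free" for Q
    using side_length_free_less[OF that] assms by linarith
  then show ?thesis unfolding large_part_def by blast
qed

lemma measure_small_part_tendsto_0: "(\<lambda>j. measure lebesgue (small_part (M / 2 ^ j))) \<longlonglongrightarrow> 0"
proof (rule tendsto_sandwich[of "\<lambda>_. 0"])
  show "\<forall>\<^sub>F j in sequentially. measure lebesgue (small_part (M / 2 ^ j)) \<le> 4 * (M / 2 ^ j) * card (gaps P)"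
    using M_pos by (intro always_eventually allI measure_small_part_le) simp
  have "(\<lambda>j. (4 * M * card (gaps P)) * (1 / 2) ^ j) \<longlonglongrightarrow> (4 * M * card (gaps P)) * 0"
    by (intro tendsto_mult_left LIMSEQ_power_zero) auto
  then show "(\<lambda>j. 4 * (M / 2 ^ j) * card (gaps P)) \<longlonglongrightarrow> 0"
    by (simp add: power_divide mult_ac)
qed auto

text \<open>\<open>GREATEST\<close> carries information only once a maximum is exhibited. Side
  lengths are dyadic fractions of \<open>M\<close>, so the measure of the large part changes only at
  such values, and the maximum is \<open>M / 2 ^ j\<close> for the least admissible
  \<open>j\<close>.\<close>

lemma large_scale_greatest:
  assumes t: "0 < t" "t < 1"
  shows "0 \<le> large_scale E {0..<M} t"
    and "t * M \<le> measure lebesgue (large_part (large_scale E {0..<M} t))"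
    and "\<And>L. 0 \<le> L \<Longrightarrow> t * M \<le> measure lebesgue (large_part L) \<Longrightarrow> L \<le> large_scale E {0..<M} t"
proof -
  let ?A = "\<lambda>L. 0 \<le> L \<and> t * M \<le> measure lebesgue (large_part L)"
  have sum: "(\<Sum>\<^sub>\<infinity>Q\<in>{Q \<in> free. L \<le> side_length Q}. measure lebesgue Q / measure lebesgue {0..<M}) =
      measure lebesgue (large_part L) / M" for L
    unfolding large_part_def by (rule infsum_free) blast
  have eq: "large_scale E {0..<M} t = (GREATEST L. ?A L)"
    unfolding large_scale_def free_def[symmetric] sum
    using M_pos by (simp add: pos_le_divide_eq)
  \<comment> \<open>Once the short cubes carry less than \<open>(1 - t) * M\<close>, the long ones
    carry at least \<open>t * M\<close>, so some exponent is admissible.\<close>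
  have "\<forall>\<^sub>F j in sequentially. measure lebesgue (small_part (M / 2 ^ j)) < (1 - t) * M"
    using measure_small_part_tendsto_0 by (rule order_tendstoD) (use t M_pos in simp)
  then obtain j0 where "measure lebesgue (small_part (M / 2 ^ j0)) < (1 - t) * M"
    by (auto simp: eventually_sequentially)
  then have "?A (M / 2 ^ j0)"
    using measure_parts[of "M / 2 ^ j0"] M_pos by (simp add: algebra_simps)
  define j where "j = (LEAST j. ?A (M / 2 ^ j))"
  have j: "?A (M / 2 ^ j)" unfolding j_def by (rule LeastI) fact
  have greatest: "L \<le> M / 2 ^ j" if L: "?A L" for L
  proof (rule ccontr)
    assume "\<not> L \<le> M / 2 ^ j"
    then have less: "M / 2 ^ j < L" by simp
    have "j \<noteq> 0"
    proof
      assume "j = 0"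
      then have "large_part L = {}" using less by (intro large_part_empty) simp
      moreover have "0 < t * M" using t M_pos by simp
      ultimately show False using L by simp
    qed
    then obtain i where i: "j = Suc i" by (metis not0_implies_Suc)
    \<comment> \<open>No side length lies strictly between \<open>M / 2 ^ j\<close> and
      \<open>M / 2 ^ i\<close>, so one exceeding the former reaches the latter.\<close>
    have "large_part L \<subseteq> large_part (M / 2 ^ i)"
    proof -
      have "M / 2 ^ i \<le> side_length Q" if Q: "Q \<in> free" "L \<le> side_length Q" for Q
      proof -
        obtain m where m: "side_length Q = M / 2 ^ Suc m" using side_length_free[OF Q(1)] .
        with Q less have "Suc m < j" using scale_less_iff[of j "Suc m"] by simp
        with m i show ?thesis using scale_less_iff[of "Suc m" i] by (metis not_le not_less_eq)
      qed
      then show ?thesis by (auto simp: large_part_def)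
    qed
    then have "?A (M / 2 ^ i)"
      using L M_pos by (smt (verit) divide_nonneg_pos fmeasurableD fmeasurable_parts(2) measure_mono_fmeasurable zero_less_power)
    moreover have "\<not> ?A (M / 2 ^ i)"
      by (rule not_less_Least) (simp add: i flip: j_def)
    ultimately show False by blast
  qed
  have "large_scale E {0..<M} t = M / 2 ^ j"
    unfolding eq using j greatest by (intro Greatest_equality) auto
  then show "0 \<le> large_scale E {0..<M} t"
    and "t * M \<le> measure lebesgue (large_part (large_scale E {0..<M} t))"
    and "\<And>L. 0 \<le> L \<Longrightarrow> t * M \<le> measure lebesgue (large_part L) \<Longrightarrow> L \<le> large_scale E {0..<M} t"
    using j greatest by auto
qed

lemma small_scale_least:
  assumes t: "0 < t" "t < 1"
  shows "0 \<le> small_scale E {0..<M} t"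
    and "t * M \<le> measure lebesgue (small_part (small_scale E {0..<M} t))"
    and "\<And>L. 0 \<le> L \<Longrightarrow> t * M \<le> measure lebesgue (small_part L) \<Longrightarrow> small_scale E {0..<M} t \<le> L"
proof -
  let ?A = "\<lambda>L. 0 \<le> L \<and> t * M \<le> measure lebesgue (small_part L)"
  have sum: "(\<Sum>\<^sub>\<infinity>Q\<in>{Q \<in> free. side_length Q \<le> L}. measure lebesgue Q / measure lebesgue {0..<M}) =
      measure lebesgue (small_part L) / M" for L
    unfolding small_part_def by (rule infsum_free) blast
  have eq: "small_scale E {0..<M} t = (LEAST L. ?A L)"
    unfolding small_scale_def free_def[symmetric] sum
    using M_pos by (simp add: pos_le_divide_eq)
  have "\<forall>\<^sub>F j in sequentially. measure lebesgue (small_part (M / 2 ^ j)) < t * M"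
    using measure_small_part_tendsto_0 by (rule order_tendstoD) (use t M_pos in simp)
  then obtain j0 where "measure lebesgue (small_part (M / 2 ^ j0)) < t * M"
    by (auto simp: eventually_sequentially)
  then have "\<not> ?A (M / 2 ^ j0)" by simp
  \<comment> \<open>Exponent 0 is admissible and some larger one is not. The minimum sits at the
    exponent \<open>i\<close> just before the first failure \<open>j\<close>.\<close>
  define j where "j = (LEAST j. \<not> ?A (M / 2 ^ j))"
  have j: "\<not> ?A (M / 2 ^ j)" unfolding j_def by (rule LeastI) fact
  have "M \<le> measure lebesgue (small_part M)"
    using measure_parts[of M] by (simp add: large_part_empty)
  moreover have "t * M \<le> 1 * M" using t M_pos by (intro mult_right_mono) auto
  ultimately have "t * M \<le> measure lebesgue (small_part M)" by linarith
  then have "?A (M / 2 ^ 0)" using M_pos by simp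
  then obtain i where i: "j = Suc i" using j by (metis not0_implies_Suc)
  have "i < (LEAST j. \<not> ?A (M / 2 ^ j))" unfolding j_def[symmetric] i by simp
  then have Ai: "?A (M / 2 ^ i)" using not_less_Least by blast
  have least: "M / 2 ^ i \<le> L" if L: "?A L" for L
  proof (rule ccontr)
    assume "\<not> M / 2 ^ i \<le> L"
    then have less: "L < M / 2 ^ i" by simp
    have "small_part L \<subseteq> small_part (M / 2 ^ j)"
    proof -
      have "side_length Q \<le> M / 2 ^ j" if Q: "Q \<in> free" "side_length Q \<le> L" for Q
      proof -
        obtain m where m: "side_length Q = M / 2 ^ Suc m" using side_length_free[OF Q(1)] .
        with Q less have "i < Suc m" using scale_less_iff[of "Suc m" i] by simp
        with m i show ?thesis using scale_less_iff[of j "Suc m"] by (metis not_le not_less_eq)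
      qed
      then show ?thesis by (auto simp: small_part_def)
    qed
    then have "?A (M / 2 ^ j)"
      using L M_pos by (smt (verit) divide_nonneg_pos fmeasurableD fmeasurable_parts(1) measure_mono_fmeasurable zero_less_power)
    with j show False by blast
  qed
  have "small_scale E {0..<M} t = M / 2 ^ i"
    unfolding eq using Ai least by (intro Least_equality) auto
  then show "0 \<le> small_scale E {0..<M} t"
    and "t * M \<le> measure lebesgue (small_part (small_scale E {0..<M} t))"
    and "\<And>L. 0 \<le> L \<Longrightarrow> t * M \<le> measure lebesgue (small_part L) \<Longrightarrow> small_scale E {0..<M} t \<le> L"
    using Ai least by auto
qed

end

subsection \<open>Binomial averages\<close>

text \<open>The expectation of \<open>F\<close> under the binomial distribution with parameters \<open>n\<close> and \<open>q\<close>.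
  The recursion matches the one satisfied by sums over the gaps of \<open>E_stage\<close>.\<close>

fun binom_avg :: "real \<Rightarrow> nat \<Rightarrow> (nat \<Rightarrow> real) \<Rightarrow> real" where
  "binom_avg q 0 F = F 0"
| "binom_avg q (Suc n) F = (1 - q) * binom_avg q n F + q * binom_avg q n (\<lambda>i. F (Suc i))"

lemma binom_avg_add: "binom_avg q n (\<lambda>i. F i + G i) = binom_avg q n F + binom_avg q n G"
  by (induction n arbitrary: F G) (simp_all add: algebra_simps)

lemma binom_avg_cmult: "binom_avg q n (\<lambda>i. a * F i) = a * binom_avg q n F"
  by (induction n arbitrary: F) (simp_all add: algebra_simps)

lemma binom_avg_const: "binom_avg q n (\<lambda>_. a) = a"
  by (induction n) (simp_all add: algebra_simps)

text \<open>The probability generating function of the binomial law.\<close>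

lemma binom_avg_power: "binom_avg q n (\<lambda>i. x ^ i) = (1 - q + q * x) ^ n"
proof (induction n)
  case (Suc n)
  then show ?case by (simp add: binom_avg_cmult algebra_simps)
qed simp

lemma binom_avg_mono:
  assumes "0 \<le> q" "q \<le> 1" "\<And>i. i \<le> n \<Longrightarrow> F i \<le> G i"
  shows "binom_avg q n F \<le> binom_avg q n G"
  using assms(3)
proof (induction n arbitrary: F G)
  case (Suc n)
  have "binom_avg q n F \<le> binom_avg q n G" "binom_avg q n (\<lambda>i. F (Suc i)) \<le> binom_avg q n (\<lambda>i. G (Suc i))"
    using Suc.prems by (auto intro!: Suc.IH)
  then show ?case using assms(1,2) by (auto intro!: add_mono mult_left_mono)
qed simp

text \<open>Thinning a binomial variable. Splitting \<open>1 / 5 = 2 / 5 * 1 / 2\<close> reduces the decay of the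
  point masses to that of the central binomial coefficients.\<close>

lemma binom_avg_mixture:
  "binom_avg (p * q) n F = binom_avg p n (\<lambda>N. binom_avg q N F)"
proof (induction n arbitrary: F)
  case (Suc n)
  let ?A = "binom_avg (p * q) n F" and ?B = "binom_avg (p * q) n (\<lambda>i. F (Suc i))"
  have "binom_avg p (Suc n) (\<lambda>N. binom_avg q N F) = (1 - p) * ?A + p * ((1 - q) * ?A + q * ?B)"
    by (simp only: binom_avg.simps binom_avg_add binom_avg_cmult Suc)
  also have "\<dots> = (1 - p * q) * ?A + p * q * ?B" by algebra
  finally show ?case by simp
qed simp

section \<open>Decay of binomial point masses\<close>

lemma binom_avg_half_point: "binom_avg (1 / 2) N (\<lambda>i. if i = j then 1 else 0) = real (N choose j) / 2 ^ N"
proof (induction N arbitrary: j)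
  case 0
  then show ?case by (cases j) auto
next
  case (Suc N)
  show ?case
    by (cases j) (simp_all add: Suc binom_avg_const field_simps)
qed

text \<open>An elementary replacement for Stirling's formula. With \<open>x = m + 1\<close>, passing
  from \<open>m\<close> to \<open>m + 1\<close> multiplies the coefficient by
  \<open>2 * (2 * x - 1) / x\<close>, and
  \<open>(2 * x - 1) * (2 * x + 1) \<le> 4 * x\<^sup>2\<close>.\<close>

lemma central_binomial_square_le: "real (2 * m choose m) ^ 2 * (2 * real m + 1) \<le> 16 ^ m"
proof (induction m)
  case (Suc m)
  define B where "B = real (2 * m choose m)"
  define C where "C = real (2 * Suc m choose Suc m)"
  define x where "x = real m + 1"
  have x: "0 < x" by (simp add: x_def)
  have 1: "(2 * Suc m choose Suc m) * Suc m = (2 * m + 2) * (2 * m + 1 choose m)"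
    using Suc_times_binomial_eq[of "2 * m + 1" m] by (simp add: mult_ac)
  have "(2 * m + 1 choose m) = (2 * m + 1 choose Suc m)"
    using binomial_symmetric[of m "2 * m + 1"] by simp
  then have "(2 * m + 1 choose m) * Suc m = (2 * m + 1) * (2 * m choose m)"
    using Suc_times_binomial_eq[of "2 * m" m] by (simp add: mult_ac)
  with 1 have "(2 * Suc m choose Suc m) * Suc m * Suc m = (2 * m + 2) * ((2 * m + 1) * (2 * m choose m))"
    by (metis mult.assoc)
  then have "real ((2 * Suc m choose Suc m) * Suc m * Suc m) = real ((2 * m + 2) * ((2 * m + 1) * (2 * m choose m)))"
    by presburger
  then have "C * x * x = 2 * (2 * x - 1) * B * x"
    unfolding C_def B_def x_def by (simp add: algebra_simps)
  then have C: "C * x = 2 * (2 * x - 1) * B" using x by simp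
  have "(C * x)\<^sup>2 * (2 * x + 1) = (B\<^sup>2 * (2 * x - 1)) * (4 * (2 * x - 1) * (2 * x + 1))"
    unfolding C by (simp add: power2_eq_square algebra_simps)
  also have "\<dots> \<le> 16 ^ m * (16 * x\<^sup>2)"
  proof (rule mult_mono)
    show "B\<^sup>2 * (2 * x - 1) \<le> 16 ^ m" using Suc by (simp add: B_def x_def algebra_simps)
    show "4 * (2 * x - 1) * (2 * x + 1) \<le> 16 * x\<^sup>2" by (simp add: power2_eq_square algebra_simps)
    show "0 \<le> 4 * (2 * x - 1) * (2 * x + 1)" by (simp add: x_def)
  qed simp
  finally have "x\<^sup>2 * (C\<^sup>2 * (2 * x + 1)) \<le> x\<^sup>2 * 16 ^ Suc m"
    by (simp add: power_mult_distrib mult_ac)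
  then have "C\<^sup>2 * (2 * x + 1) \<le> 16 ^ Suc m"
    using x by (simp add: mult_le_cancel_left_pos del: power_Suc)
  then show ?case by (simp add: C_def x_def add.commute)
qed simp

text \<open>Each step in \<open>N\<close> averages two adjacent point masses, so the largest one
  never grows. It suffices to bound the central mass at \<open>2 * m\<close>.\<close>

lemma binom_avg_half_point_le:
  assumes "2 * m \<le> N"
  shows "binom_avg (1 / 2) N (\<lambda>i. if i = j then 1 else 0) \<le> 1 / sqrt (2 * real m + 1)"
  using assms
proof (induction N arbitrary: j rule: dec_induct)
  case base
  have "real (2 * m choose m) ^ 2 * (2 * real m + 1) \<le> (4 ^ m)\<^sup>2"
    using central_binomial_square_le[of m] by (simp add: power2_eq_square flip: power_mult_distrib)
  then have "sqrt (real (2 * m choose m) ^ 2 * (2 * real m + 1)) \<le> 4 ^ m"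
    by (intro real_le_lsqrt) auto
  then have "real (2 * m choose m) * sqrt (2 * real m + 1) \<le> 4 ^ m"
    unfolding real_sqrt_mult by simp
  then have "real (2 * m choose m) / 4 ^ m \<le> 1 / sqrt (2 * real m + 1)"
    by (simp add: field_simps)
  moreover have "real (2 * m choose j) / 4 ^ m \<le> real (2 * m choose m) / 4 ^ m"
    by (intro divide_right_mono) (simp_all add: binomial_maximum')
  ultimately show ?case
    unfolding binom_avg_half_point power_mult by simp
next
  case (step N)
  have "binom_avg (1 / 2) (Suc N) (\<lambda>i. if i = j then 1 else 0) \<le> b"
    if "\<And>j. binom_avg (1 / 2) N (\<lambda>i. if i = j then 1 else 0) \<le> b" "0 \<le> b" for b
    using that(1)[of j] that(1)[of "j - 1"] that(2) by (cases j) (simp_all add: binom_avg_const)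
  then show ?case using step.IH by simp
qed

lemma binom_avg_fifth_point_eventually_le:
  assumes "0 < e"
  shows "\<forall>\<^sub>F n in sequentially. \<forall>j. binom_avg (1 / 5) n (\<lambda>i. if i = j then 1 else 0) \<le> e"
proof -
  \<comment> \<open>This \<open>m\<close> makes the point masses for \<open>2 * m \<le> N\<close> at
    most \<open>e / 2\<close>; the other half of \<open>e\<close> is reserved for
    \<open>N < 2 * m\<close>.\<close>
  obtain m :: nat where m: "4 / e\<^sup>2 < real m" using reals_Archimedean2 by blast
  define b where "b = 1 / sqrt (2 * real m + 1)"
  have "(2 / e)\<^sup>2 \<le> 2 * real m + 1" using m by (simp add: power_divide)
  then have "2 / e \<le> sqrt (2 * real m + 1)" using real_le_rsqrt by blast
  then have b: "b \<le> e / 2" "0 \<le> b" using assms unfolding b_def by (simp_all add: field_simps)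
  have "(\<lambda>n. 2 ^ (2 * m) * (4 / 5 :: real) ^ n) \<longlonglongrightarrow> 2 ^ (2 * m) * 0"
    by (intro tendsto_mult_left LIMSEQ_power_zero) auto
  then have "\<forall>\<^sub>F n in sequentially. 2 ^ (2 * m) * (4 / 5 :: real) ^ n < e / 2"
    using assms by (intro order_tendstoD(2)[of _ 0]) auto
  then show ?thesis
  proof eventually_elim
    case (elim n)
    show ?case
    proof
      fix j :: nat
      let ?\<delta> = "\<lambda>i. if i = j then 1 else 0 :: real"
      have "binom_avg (1 / 5) n ?\<delta> = binom_avg (2 / 5) n (\<lambda>N. binom_avg (1 / 2) N ?\<delta>)"
        using binom_avg_mixture[of "2 / 5" "1 / 2" n ?\<delta>] by simp
      \<comment> \<open>The first summand is at least 1 when \<open>N < 2 * m\<close>. It replaces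
        the probability of that event by an exponential moment, which the generating function
        evaluates as a multiple of \<open>(4 / 5) ^ n\<close>.\<close>
      also have "\<dots> \<le> binom_avg (2 / 5) n (\<lambda>N. 2 ^ (2 * m) * (1 / 2) ^ N + b)"
      proof (rule binom_avg_mono)
        fix N
        show "binom_avg (1 / 2) N ?\<delta> \<le> 2 ^ (2 * m) * (1 / 2) ^ N + b"
        proof (cases "2 * m \<le> N")
          case True
          then have "binom_avg (1 / 2) N ?\<delta> \<le> b" unfolding b_def by (rule binom_avg_half_point_le)
          moreover have "0 \<le> 2 ^ (2 * m) * (1 / 2 :: real) ^ N" by simp
          ultimately show ?thesis by linarith
        next
          case False
          have "binom_avg (1 / 2) N ?\<delta> \<le> binom_avg (1 / 2) N (\<lambda>_. 1)"
            by (intro binom_avg_mono) auto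
          also have "\<dots> = 1" by (rule binom_avg_const)
          also have "(1::real) \<le> 2 ^ (2 * m) / 2 ^ N"
            using False by (simp add: power_increasing)
          also have "\<dots> \<le> 2 ^ (2 * m) * (1 / 2) ^ N + b"
            using b by (simp add: power_divide)
          finally show ?thesis .
        qed
      qed auto
      also have "\<dots> = 2 ^ (2 * m) * (4 / 5) ^ n + b"
        by (simp add: binom_avg_add binom_avg_cmult binom_avg_const binom_avg_power)
      also have "\<dots> \<le> e" using elim b by simp
      finally show "binom_avg (1 / 5) n ?\<delta> \<le> e" .
    qed
  qed
qed

text \<open>Take \<open>k\<close> to be the lower quartile. The mass strictly below \<open>k\<close>
  is at most \<open>1 / 4\<close>, and the next \<open>m\<close> atoms, each of mass at most
  \<open>d\<close>, add at most \<open>1 / 2\<close>. This leaves at least \<open>1 / 4\<close> from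
  \<open>k + m\<close> on.\<close>

lemma binom_avg_fifth_spread:
  "\<forall>\<^sub>F n in sequentially. \<exists>k.
     1 / 4 \<le> binom_avg (1 / 5) n (\<lambda>i. if i \<le> k then 1 else 0) \<and>
     1 / 4 \<le> binom_avg (1 / 5) n (\<lambda>i. if k + m \<le> i then 1 else 0)"
proof -
  define d where "d = 1 / (2 * (real m + 1))"
  have "0 < d" by (simp add: d_def)
  from binom_avg_fifth_point_eventually_le[OF this] show ?thesis
  proof eventually_elim
    case (elim n)
    define F where "F k = binom_avg (1 / 5) n (\<lambda>i. if i < k then 1 else 0)" for k
    have F_Suc: "F (Suc k) = F k + binom_avg (1 / 5) n (\<lambda>i. if i = k then 1 else 0)" for k
      unfolding F_def binom_avg_add[symmetric] by (intro arg_cong[of _ _ "binom_avg _ _"]) auto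
    have "1 = binom_avg (1 / 5) n (\<lambda>_. 1)" by (simp add: binom_avg_const)
    also have "\<dots> \<le> F (Suc n)" unfolding F_def by (intro binom_avg_mono) auto
    finally have "1 / 4 \<le> F (Suc n)" by simp
    define k where "k = (LEAST k. 1 / 4 \<le> F (Suc k))"
    have k: "1 / 4 \<le> F (Suc k)" unfolding k_def by (rule LeastI) fact
    have "F k \<le> 1 / 4"
    proof (cases k)
      case 0
      then show ?thesis by (simp add: F_def binom_avg_const)
    next
      case (Suc l)
      then have "l < (LEAST k. 1 / 4 \<le> F (Suc k))" unfolding k_def[symmetric] by simp
      then have "\<not> 1 / 4 \<le> F (Suc l)" by (rule not_less_Least)
      then show ?thesis using Suc by simp
    qed
    moreover have F_add: "F (k + i) \<le> F k + real i * d" for i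
    proof (induction i)
      case (Suc i)
      then show ?case using F_Suc[of "k + i"] elim[rule_format, of "k + i"] by (simp add: algebra_simps)
    qed simp
    moreover have "real m * d \<le> 1 / 2" by (simp add: d_def field_simps)
    ultimately have "F (k + m) \<le> 3 / 4" using F_add[of m] by linarith
    moreover have "F (k + m) + binom_avg (1 / 5) n (\<lambda>i. if k + m \<le> i then 1 else 0) = 1"
    proof -
      have "(\<lambda>i. (if i < k + m then 1 else 0) + (if k + m \<le> i then 1 else 0 :: real)) = (\<lambda>_. 1)" by auto
      then show ?thesis
        unfolding F_def binom_avg_add[symmetric] by (simp add: binom_avg_const)
    qed
    ultimately have "1 / 4 \<le> binom_avg (1 / 5) n (\<lambda>i. if k + m \<le> i then 1 else 0)" by simp
    moreover have "F (Suc k) = binom_avg (1 / 5) n (\<lambda>i. if i \<le> k then 1 else 0)"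
      by (simp add: F_def less_Suc_eq_le)
    ultimately show ?case using k by auto
  qed
qed

subsection \<open>The stages of the construction\<close>

lemma translate_first_to_eq:
  assumes "finite A" "0 \<in> A" "\<And>x. x \<in> A \<Longrightarrow> 0 \<le> x" "0 < k"
  shows "translate_first_to p ((\<lambda>x. k * x) ` A) = (\<lambda>x. p + k * x) ` A"
proof -
  have "Min ((\<lambda>x. k * x) ` A) = 0"
    using assms by (intro Min_eqI) (auto intro: image_eqI[of _ _ 0])
  then show ?thesis
    by (simp add: translate_first_to_def image_image add.commute)
qed

lemma Max_affine_image:
  fixes A :: "real set"
  assumes "finite A" "A \<noteq> {}" "0 < k"
  shows "Max ((\<lambda>x. p + k * x) ` A) = p + k * Max A"
  using assms by (intro Max_eqI) auto

lemma gap_sum_unit: "gap_sum {0, 1} f = f 1"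
proof -
  have "gaps {0, 1} = {(0, 1 :: real)}" by (auto simp: gaps_def)
  then show ?thesis by (simp add: gap_sum_def)
qed

locale ratios =
  fixes c :: "nat \<Rightarrow> real"
  assumes ratio_pos: "0 < c (Suc n)"
begin

definition width :: "nat \<Rightarrow> real" where
  "width n = Max (E_stage c n)"

text \<open>The form of the next stage relies on the basic facts about the current one, which in
  turn are propagated by that form; hence the joint proof. The factor \<open>1\<close> in the last
  copy keeps it in the affine shape of \<open>gap_sum_affine\<close>.\<close>

lemma stage_basics:
  "finite (E_stage c n) \<and> 0 \<in> E_stage c n \<and> width n \<in> E_stage c n \<and> 0 < width n \<and>
   E_stage c n \<subseteq> {0..width n}"
  and stage_Suc:
  "E_stage c (Suc n) = (E_stage c n \<union> (\<lambda>x. width n + c (Suc n) * x) ` E_stage c n) \<union>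
     (\<lambda>x. (width n + c (Suc n) * width n) + 1 * x) ` E_stage c n"
  and width_Suc: "width (Suc n) = (2 + c (Suc n)) * width n"
proof -
  have step: "E_stage c (Suc n) = (E_stage c n \<union> (\<lambda>x. width n + c (Suc n) * x) ` E_stage c n) \<union>
     (\<lambda>x. (width n + c (Suc n) * width n) + 1 * x) ` E_stage c n"
    "width (Suc n) = (2 + c (Suc n)) * width n"
    if basics: "finite (E_stage c n)" "0 \<in> E_stage c n" "0 < width n" "E_stage c n \<subseteq> {0..width n}" for n
  proof -
    let ?A = "E_stage c n" and ?g = "width n" and ?k = "c (Suc n)"
    have ne: "?A \<noteq> {}" and nonneg: "\<And>x. x \<in> ?A \<Longrightarrow> 0 \<le> x" using basics by auto
    have A1: "translate_first_to ?g ((\<lambda>x. ?k * x) ` ?A) = (\<lambda>x. ?g + ?k * x) ` ?A"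
      by (rule translate_first_to_eq) (use basics nonneg ratio_pos in auto)
    have M1: "Max ((\<lambda>x. ?g + ?k * x) ` ?A) = ?g + ?k * ?g"
      using Max_affine_image[OF basics(1) ne ratio_pos] by (simp add: width_def)
    have A2: "translate_first_to p ?A = (\<lambda>x. p + 1 * x) ` ?A" for p
      using translate_first_to_eq[OF basics(1,2) nonneg, of 1 p] by simp
    show Suc: "E_stage c (Suc n) = (?A \<union> (\<lambda>x. ?g + ?k * x) ` ?A) \<union> (\<lambda>x. (?g + ?k * ?g) + 1 * x) ` ?A"
      by (simp only: E_stage.simps Let_def width_def[symmetric] A1 M1 A2)
    have "?g \<in> ?A" unfolding width_def using basics(1) ne by (rule Max_in)
    have "0 < ?k * ?g" using ratio_pos basics(3) by simp
    have "width (Suc n) = (?g + ?k * ?g) + 1 * ?g"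
      unfolding width_def[of "Suc n"]
    proof (rule Max_eqI)
      show "finite (E_stage c (Suc n))" unfolding Suc using basics(1) by simp
      show "(?g + ?k * ?g) + 1 * ?g \<in> E_stage c (Suc n)" unfolding Suc using \<open>?g \<in> ?A\<close> by blast
      fix y assume "y \<in> E_stage c (Suc n)"
      then consider "y \<in> ?A" | x where "x \<in> ?A" "y = ?g + ?k * x" | x where "x \<in> ?A" "y = (?g + ?k * ?g) + 1 * x"
        unfolding Suc by blast
      then show "y \<le> (?g + ?k * ?g) + 1 * ?g"
      proof cases
        case 1
        then have "y \<le> ?g" using basics(4) by auto
        then show ?thesis using \<open>0 < ?k * ?g\<close> basics(3) by linarith
      next
        case 2
        then have "?k * x \<le> ?k * ?g" using basics(4) ratio_pos[of n] by (intro mult_left_mono) auto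
        then show ?thesis using 2 basics(3) by linarith
      next
        case 3
        then have "x \<le> ?g" using basics(4) by auto
        then show ?thesis using 3 by linarith
      qed
    qed
    then show "width (Suc n) = (2 + ?k) * ?g" by (simp add: algebra_simps)
  qed
  have basics: "finite (E_stage c n) \<and> 0 \<in> E_stage c n \<and> 0 < width n \<and> E_stage c n \<subseteq> {0..width n}" for n
  proof (induction n)
    case 0
    then show ?case by (simp add: width_def)
  next
    case (Suc n)
    have S: "E_stage c (Suc n) = (E_stage c n \<union> (\<lambda>x. width n + c (Suc n) * x) ` E_stage c n) \<union>
       (\<lambda>x. (width n + c (Suc n) * width n) + 1 * x) ` E_stage c n"
      "width (Suc n) = (2 + c (Suc n)) * width n"
      using step Suc by blast+
    have fin: "finite (E_stage c (Suc n))" using S(1) Suc by simp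
    have nonneg: "0 \<le> y" if "y \<in> E_stage c (Suc n)" for y
    proof -
      have *: "0 \<le> x" if "x \<in> E_stage c n" for x using Suc that by auto
      have "0 \<le> width n" "0 \<le> c (Suc n)" using Suc ratio_pos[of n] by auto
      with * that show ?thesis unfolding S(1) by auto
    qed
    have "E_stage c (Suc n) \<subseteq> {0..width (Suc n)}"
      unfolding width_def using fin nonneg by auto
    moreover have "0 \<in> E_stage c (Suc n)" using S(1) Suc by blast
    moreover have "0 < width (Suc n)" unfolding S(2) using ratio_pos[of n] Suc by simp
    ultimately show ?case using fin by blast
  qed
  moreover have "width n \<in> E_stage c n"
    unfolding width_def using basics[of n] by (intro Max_in) auto
  ultimately show "finite (E_stage c n) \<and> 0 \<in> E_stage c n \<and> width n \<in> E_stage c n \<and> 0 < width n \<and>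
   E_stage c n \<subseteq> {0..width n}" by blast
  show "E_stage c (Suc n) = (E_stage c n \<union> (\<lambda>x. width n + c (Suc n) * x) ` E_stage c n) \<union>
     (\<lambda>x. (width n + c (Suc n) * width n) + 1 * x) ` E_stage c n"
    "width (Suc n) = (2 + c (Suc n)) * width n"
    using step basics by blast+
qed

text \<open>Three copies are glued end to end, so their gap sums add. The outer two have the
  original gap lengths, the middle one rescales them.\<close>

lemma gap_sum_stage_Suc:
  "gap_sum (E_stage c (Suc n)) f =
     2 * gap_sum (E_stage c n) f + gap_sum (E_stage c n) (\<lambda>x. f (c (Suc n) * x))"
proof -
  let ?A = "E_stage c n" and ?g = "width n" and ?k = "c (Suc n)"
  let ?A1 = "(\<lambda>x. ?g + ?k * x) ` ?A" and ?A2 = "(\<lambda>x. (?g + ?k * ?g) + 1 * x) ` ?A"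
  have fin: "finite ?A" and A: "0 \<in> ?A" "?g \<in> ?A" "0 < ?g" and le: "\<And>x. x \<in> ?A \<Longrightarrow> 0 \<le> x \<and> x \<le> ?g"
    using stage_basics[of n] by auto
  have k: "0 < ?k" by (rule ratio_pos)
  have kg: "0 < ?k * ?g" using k A by simp
  have le1: "?g \<le> y \<and> y \<le> ?g + ?k * ?g" if y: "y \<in> ?A1" for y
  proof -
    obtain x where x: "x \<in> ?A" "y = ?g + ?k * x" using y by blast
    then show ?thesis using le[OF x(1)] k by (simp add: mult_left_mono)
  qed
  have "gap_sum (E_stage c (Suc n)) f = gap_sum (?A \<union> ?A1) f + gap_sum ?A2 f"
    unfolding stage_Suc
  proof (rule gap_sum_Un[where m = "?g + ?k * ?g"])
    show "?g + ?k * ?g \<in> ?A \<union> ?A1" using A by blast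
    show "?g + ?k * ?g \<in> ?A2" using A(1) by (intro image_eqI[of _ _ 0]) auto
    show "y \<le> ?g + ?k * ?g" if "y \<in> ?A \<union> ?A1" for y
      using that le[of y] le1[of y] kg by auto
    show "?g + ?k * ?g \<le> y" if "y \<in> ?A2" for y
      using that le by auto
  qed (use fin in auto)
  also have "gap_sum (?A \<union> ?A1) f = gap_sum ?A f + gap_sum ?A1 f"
  proof (rule gap_sum_Un[where m = ?g])
    show "?g \<in> ?A1" using A(1) by (intro image_eqI[of _ _ 0]) auto
  qed (use fin A le le1 in auto)
  also have "gap_sum ?A1 f = gap_sum ?A (\<lambda>x. f (?k * x))"
    using k by (rule gap_sum_affine)
  also have "gap_sum ?A2 f = gap_sum ?A f"
    using gap_sum_affine[of 1 "?g + ?k * ?g" ?A f] by simp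
  finally show ?thesis by simp
qed

lemma card_gaps_stage: "real (card (gaps (E_stage c n))) = 3 ^ n"
proof -
  have "gap_sum (E_stage c n) (\<lambda>_. 1) = 3 ^ n"
    by (induction n) (simp_all add: gap_sum_unit gap_sum_stage_Suc del: E_stage.simps(2))
  then show ?thesis by (simp add: gap_sum_def case_prod_unfold)
qed

lemma stage_mono: "m \<le> n \<Longrightarrow> E_stage c m \<subseteq> E_stage c n"
  by (rule lift_Suc_mono_le) (use stage_Suc in blast)+

text \<open>Every point added after stage \<open>n\<close> lies at or beyond \<open>width n\<close>,
  because the copies are attached at the right end.\<close>

lemma stage_below_width:
  assumes "n \<le> m"
  shows "width n \<le> width m \<and> E_stage c m \<inter> {..<width n} \<subseteq> E_stage c n"
  using assms
proof (induction m rule: dec_induct)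
  case (step m)
  have A: "0 < width m" "E_stage c m \<subseteq> {0..width m}" using stage_basics[of m] by auto
  have k: "0 < c (Suc m)" by (rule ratio_pos)
  have "0 < c (Suc m) * width m" using k A by simp
  then have "width m \<le> width (Suc m)" unfolding width_Suc distrib_right using A by linarith
  moreover have "x \<in> E_stage c m" if x: "x \<in> E_stage c (Suc m)" "x < width n" for x
  proof (rule ccontr)
    assume "x \<notin> E_stage c m"
    with x(1) obtain y where y: "y \<in> E_stage c m"
      "x = width m + c (Suc m) * y \<or> x = width m + c (Suc m) * width m + 1 * y"
      unfolding stage_Suc by blast
    then have "0 \<le> y" "0 \<le> c (Suc m) * y" using A k by auto
    then have "width m \<le> x" using y(2) \<open>0 < c (Suc m) * width m\<close> by auto
    then show False using x(2) step.IH by simp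
  qed
  ultimately show ?case using step.IH by (auto intro: order_trans)
qed auto

text \<open>A symmetric open interval is used because 0 is the left end of the cube. Inside it
  \<open>E_set c\<close> is part of a finite, hence closed, set, so taking the closure adds nothing
  beyond that set; of the reflected half only 0 falls in the cube.\<close>

lemma closure_E_set: "closure (E_set c) \<inter> {0..<width n} = E_stage c n \<inter> {0..<width n}"
proof
  have sub: "E_stage c n \<subseteq> E_set c" by (auto simp: E_set_def E_plus_def)
  then show "E_stage c n \<inter> {0..<width n} \<subseteq> closure (E_set c) \<inter> {0..<width n}"
    using closure_subset by blast
  let ?S = "{- width n<..<width n}"
  have plus: "E_plus c \<inter> {..<width n} \<subseteq> E_stage c n"
  proof
    fix x assume "x \<in> E_plus c \<inter> {..<width n}"
    then obtain m where m: "x \<in> E_stage c m" "x < width n" by (auto simp: E_plus_def)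
    have "x \<in> E_stage c (max m n)" using m(1) stage_mono[of m "max m n"] by auto
    then show "x \<in> E_stage c n" using stage_below_width[of n "max m n"] m(2) by auto
  qed
  have "?S \<inter> E_set c \<subseteq> E_stage c n \<union> uminus ` E_stage c n"
  proof
    fix x assume x: "x \<in> ?S \<inter> E_set c"
    then consider "x \<in> E_plus c" | y where "y \<in> E_plus c" "x = - y"
      by (auto simp: E_set_def E_minus_def)
    then show "x \<in> E_stage c n \<union> uminus ` E_stage c n"
      using x plus by cases auto
  qed
  then have "closure (?S \<inter> E_set c) \<subseteq> E_stage c n \<union> uminus ` E_stage c n"
    using stage_basics[of n] by (intro closure_minimal finite_imp_closed) auto
  moreover have "?S \<inter> closure (E_set c) \<subseteq> closure (?S \<inter> E_set c)"
    by (rule open_Int_closure_subset) simp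
  ultimately have cl: "?S \<inter> closure (E_set c) \<subseteq> E_stage c n \<union> uminus ` E_stage c n" by blast
  show "closure (E_set c) \<inter> {0..<width n} \<subseteq> E_stage c n \<inter> {0..<width n}"
  proof
    fix x assume x: "x \<in> closure (E_set c) \<inter> {0..<width n}"
    then have "x \<in> ?S \<inter> closure (E_set c)" by auto
    with cl have "x \<in> E_stage c n \<union> uminus ` E_stage c n" by blast
    then have "x \<in> E_stage c n"
    proof
      assume "x \<in> uminus ` E_stage c n"
      then obtain y where y: "y \<in> E_stage c n" "x = - y" by blast
      then have "0 \<le> y" using stage_basics[of n] by auto
      then have "x = 0" using x y(2) by simp
      then show ?thesis using stage_basics[of n] by simp
    qed
    then show "x \<in> E_stage c n \<inter> {0..<width n}" using x by blast
  qed
qed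

lemma stopping_cubes_stage: "stopping_cubes (width n) (E_stage c n) (E_set c)"
  using stage_basics[of n] closure_E_set[of n] by unfold_locales auto

lemma Q_stage_eq: "Q_stage c n = {0..<width n}"
  by (simp add: Q_stage_def width_def)

section \<open>Bounds for both scales by sums over the gaps of a stage\<close>

lemma large_scale_bound:
  assumes "0 < t" "t < 1"
  shows "t * width n * large_scale (E_set c) (Q_stage c n) t \<le> gap_sum (E_stage c n) (\<lambda>x. x\<^sup>2)"
proof -
  interpret stopping_cubes "width n" "E_stage c n" "E_set c" by (rule stopping_cubes_stage)
  let ?L = "large_scale (E_set c) {0..<width n} t"
  have "t * width n * ?L \<le> measure lebesgue (large_part ?L) * ?L"
    using large_scale_greatest(1,2)[OF assms] by (intro mult_right_mono)
  also have "\<dots> \<le> gap_sum (E_stage c n) (\<lambda>x. x\<^sup>2)" by (rule measure_large_part_le)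
  finally show ?thesis by (simp add: Q_stage_eq)
qed

lemma small_scale_bound:
  assumes "0 < t" "t < 1"
  shows "t * width n \<le> 4 * 3 ^ n * small_scale (E_set c) (Q_stage c n) t"
proof -
  interpret stopping_cubes "width n" "E_stage c n" "E_set c" by (rule stopping_cubes_stage)
  let ?S = "small_scale (E_set c) {0..<width n} t"
  have "t * width n \<le> measure lebesgue (small_part ?S)" by (rule small_scale_least(2)[OF assms])
  also have "\<dots> \<le> 4 * ?S * card (gaps (E_stage c n))"
    by (rule measure_small_part_le) (rule small_scale_least(1)[OF assms])
  finally show ?thesis by (simp add: Q_stage_eq card_gaps_stage mult_ac)
qed

text \<open>The factor 2 compensates for the fact that only half of each long gap is guaranteed to
  be covered by cubes of length at least \<open>r / 8\<close>.\<close>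

lemma large_scale_ge:
  assumes "0 < t" "t < 1" "0 \<le> r"
    "2 * t * width n \<le> gap_sum (E_stage c n) (\<lambda>x. if r \<le> x then x else 0)"
  shows "r / 8 \<le> large_scale (E_set c) (Q_stage c n) t"
proof -
  interpret stopping_cubes "width n" "E_stage c n" "E_set c" by (rule stopping_cubes_stage)
  have "t * width n \<le> measure lebesgue (large_part (r / 8))"
    using measure_large_part_ge[OF assms(3)] assms(4) by linarith
  then show ?thesis
    using large_scale_greatest(3)[OF assms(1,2), of "r / 8"] assms(3) by (simp add: Q_stage_eq)
qed

lemma small_scale_le:
  assumes "0 < t" "t < 1" "0 \<le> r"
    "t * width n \<le> gap_sum (E_stage c n) (\<lambda>x. if x \<le> r then x else 0)"
  shows "small_scale (E_set c) (Q_stage c n) t \<le> r"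
proof -
  interpret stopping_cubes "width n" "E_stage c n" "E_set c" by (rule stopping_cubes_stage)
  show ?thesis
    using small_scale_least(3)[OF assms(1,2,3)] measure_small_part_ge[of r] assms(4)
    by (simp add: Q_stage_eq)
qed

end

subsection \<open>Comparability and divergence of the scales\<close>

text \<open>The constant 128 is the product of 16 from the two thresholds \<open>1 / 4\<close>, 4
  from the margin bound for short cubes, and 2 from the second moment estimate.\<close>

lemma harmonic_scales_comparable:
  defines "c \<equiv> \<lambda>n::nat. 1 - 1 / (2 * real n)"
  shows "large_scale (E_set c) (Q_stage c n) (1 / 4) \<le> 128 * small_scale (E_set c) (Q_stage c n) (1 / 4)"
proof -
  interpret ratios c
    by unfold_locales (simp add: c_def field_simps)
  let ?sq = "\<lambda>n. gap_sum (E_stage c n) (\<lambda>x. x\<^sup>2)"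
  have width_pos: "0 < width n" for n using stage_basics[of n] by blast
  have sq_Suc: "?sq (Suc n) = (2 + (c (Suc n))\<^sup>2) * ?sq n" for n
    unfolding gap_sum_stage_Suc
    by (simp add: gap_sum_def power_mult_distrib sum_distrib_left case_prod_unfold distrib_right sum.distrib)
  have sq_nonneg: "0 \<le> ?sq n" for n
    unfolding gap_sum_def by (intro sum_nonneg) auto
  \<comment> \<open>The factor \<open>2 - 1 / (real n + 1)\<close> equals 1 at the start, stays
    below 2, and grows just fast enough to absorb the factors \<open>1 + O(1 / n\<^sup>2)\<close>. A
    constant factor would not carry the induction.\<close>
  have second_moment: "3 ^ n * ?sq n \<le> (2 - 1 / (real n + 1)) * (width n)\<^sup>2" for n
  proof (induction n)
    case 0
    have "width 0 = 1" by (simp add: width_def)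
    then show ?case by (simp add: gap_sum_unit)
  next
    case (Suc n)
    define y where "y = 1 / (real n + 1)"
    define k where "k = c (Suc n)"
    have y: "0 < y" "y \<le> 1" by (simp_all add: y_def)
    have k: "k = 1 - y / 2" by (simp add: k_def c_def y_def)
    \<comment> \<open>The excess \<open>3 * (2 + k\<^sup>2) - (2 + k)\<^sup>2\<close> equals
      \<open>2 * (1 - k)\<^sup>2 = y\<^sup>2 / 2\<close>, and \<open>(2 + k)\<^sup>2\<close> is at
      least 4.\<close>
    have factor: "3 * (2 + k\<^sup>2) \<le> (1 + y\<^sup>2 / 8) * (2 + k)\<^sup>2"
    proof -
      have "4 \<le> (2 + k)\<^sup>2" using y k power_mono[of 2 "2 + k" 2] by simp
      then have "y\<^sup>2 / 8 * 4 \<le> y\<^sup>2 / 8 * (2 + k)\<^sup>2" by (intro mult_left_mono) auto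
      moreover have "3 * (2 + k\<^sup>2) = (2 + k)\<^sup>2 + y\<^sup>2 / 2"
        unfolding k by (simp add: power2_eq_square field_simps)
      ultimately show ?thesis by (simp add: distrib_right)
    qed
    \<comment> \<open>The new factor costs at most \<open>y\<^sup>2 / 4\<close>, while the bound
      rises by \<open>y\<^sup>2 / (1 + y)\<close>, which is at least
      \<open>y\<^sup>2 / 2\<close>.\<close>
    have telescope: "(2 - y) * (1 + y\<^sup>2 / 8) \<le> 2 - 1 / (real (Suc n) + 1)"
    proof -
      have n: "real n = 1 / y - 1" by (simp add: y_def)
      have "1 / (real (Suc n) + 1) = y / (1 + y)"
        unfolding of_nat_Suc n using y by (simp add: field_simps)
      also have "\<dots> = y - y\<^sup>2 / (1 + y)"
        using y by (simp add: field_simps power2_eq_square)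
      finally have "1 / (real (Suc n) + 1) = y - y\<^sup>2 / (1 + y)" .
      moreover have "y\<^sup>2 / 2 \<le> y\<^sup>2 / (1 + y)" using y by (intro divide_left_mono) auto
      moreover have "(2 - y) * (1 + y\<^sup>2 / 8) = 2 - y + y\<^sup>2 / 4 - y * y\<^sup>2 / 8"
        by (simp add: power2_eq_square field_simps)
      moreover have "0 \<le> y * y\<^sup>2" "0 \<le> y\<^sup>2" using y by simp_all
      ultimately show ?thesis by linarith
    qed
    have "3 ^ Suc n * ?sq (Suc n) = (3 * (2 + k\<^sup>2)) * (3 ^ n * ?sq n)"
      unfolding sq_Suc k_def by simp
    also have "\<dots> \<le> ((1 + y\<^sup>2 / 8) * (2 + k)\<^sup>2) * ((2 - y) * (width n)\<^sup>2)"
    proof (rule mult_mono[OF factor])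
      show "3 ^ n * ?sq n \<le> (2 - y) * (width n)\<^sup>2" using Suc unfolding y_def .
      show "0 \<le> 3 ^ n * ?sq n" using sq_nonneg by simp
    qed simp
    also have "\<dots> = ((2 - y) * (1 + y\<^sup>2 / 8)) * (width (Suc n))\<^sup>2"
      unfolding width_Suc k_def by (simp add: power_mult_distrib)
    also have "\<dots> \<le> (2 - 1 / (real (Suc n) + 1)) * (width (Suc n))\<^sup>2"
      using telescope by (rule mult_right_mono) simp
    finally show ?case .
  qed
  let ?L = "large_scale (E_set c) (Q_stage c n) (1 / 4)" and ?S = "small_scale (E_set c) (Q_stage c n) (1 / 4)"
  have L: "1 / 4 * width n * ?L \<le> ?sq n" by (rule large_scale_bound) auto
  have S: "1 / 4 * width n \<le> 4 * 3 ^ n * ?S" by (rule small_scale_bound) auto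
  then have "0 < 4 * 3 ^ n * ?S" using width_pos[of n] by linarith
  then have "0 < ?S" by (simp add: zero_less_mult_iff)
  have "(1 / 4 * width n * ?L) * (1 / 4 * width n) \<le> ?sq n * (4 * 3 ^ n * ?S)"
    by (rule mult_mono[OF L S]) (use sq_nonneg[of n] width_pos[of n] in auto)
  also have "\<dots> = 4 * ?S * (3 ^ n * ?sq n)" by simp
  also have "\<dots> \<le> 4 * ?S * ((2 - 1 / (real n + 1)) * (width n)\<^sup>2)"
    using second_moment \<open>0 < ?S\<close> by (intro mult_left_mono) auto
  also have "\<dots> \<le> 4 * ?S * (2 * (width n)\<^sup>2)"
    using \<open>0 < ?S\<close> by (intro mult_left_mono mult_right_mono) auto
  finally have "(width n)\<^sup>2 * ?L \<le> (width n)\<^sup>2 * (128 * ?S)"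
    by (simp add: power2_eq_square mult_ac)
  then show ?thesis using width_pos[of n] by (simp add: mult_le_cancel_left_pos)
qed

lemma half_scales_diverge:
  assumes t: "0 < t" "t < 1 / 8"
  defines "c \<equiv> \<lambda>_::nat. 1 / 2 :: real"
  shows "filterlim (\<lambda>n. large_scale (E_set c) (Q_stage c n) t / small_scale (E_set c) (Q_stage c n) t)
    at_top sequentially"
proof -
  interpret ratios c by unfold_locales (simp add: c_def)
  have c: "c n = 1 / 2" for n by (simp add: c_def)
  have width: "width n = (5 / 2) ^ n" for n
  proof (induction n)
    case 0
    show ?case by (simp add: width_def)
  next
    case (Suc n)
    then show ?case using width_Suc[of n] c[of "Suc n"] by simp
  qed
  \<comment> \<open>Here \<open>1 / 5\<close> is the share of the middle copy in the new width,
    \<open>(1 / 2) / (5 / 2)\<close>, and \<open>(1 / 2) ^ i\<close> is the length of a gap that was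
    halved \<open>i\<close> times. The weight \<open>2 ^ i\<close> cancels that length when
    \<open>f x\<close> is \<open>x\<close> times an indicator, leaving a binomial
    probability.\<close>
  have gap_sum: "gap_sum (E_stage c n) f = width n * binom_avg (1 / 5) n (\<lambda>i. 2 ^ i * f ((1 / 2) ^ i))" for n f
  proof (induction n arbitrary: f)
    case 0
    show ?case by (simp add: gap_sum_unit width)
  next
    case (Suc n)
    let ?A = "binom_avg (1 / 5) n (\<lambda>i. 2 ^ i * f ((1 / 2) ^ i))"
    let ?B = "binom_avg (1 / 5) n (\<lambda>i. 2 ^ i * f ((1 / 2) ^ Suc i))"
    have "gap_sum (E_stage c (Suc n)) f = 2 * (width n * ?A) + width n * ?B"
      unfolding gap_sum_stage_Suc Suc c by simp
    moreover have "binom_avg (1 / 5) (Suc n) (\<lambda>i. 2 ^ i * f ((1 / 2) ^ i)) = 4 / 5 * ?A + 1 / 5 * (2 * ?B)"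
      by (simp only: binom_avg.simps binom_avg_cmult power_Suc[of 2] mult.assoc) simp
    ultimately show ?case by (simp add: width field_simps)
  qed
  have pow_le: "(1 / 2 :: real) ^ i \<le> (1 / 2) ^ j \<longleftrightarrow> j \<le> i" for i j
    by (simp add: power_decreasing_iff)
  have pow_mult: "2 ^ i * (if b then (1 / 2) ^ i else 0) = (if b then 1 else 0 :: real)" for i b
    by (simp add: power_divide)
  show ?thesis
    unfolding filterlim_at_top
  proof
    fix Z :: real
    \<comment> \<open>The scales will be separated by a factor \<open>2 ^ m / 8\<close>, where 8 is
      the loss in \<open>large_scale_ge\<close>.\<close>
    obtain m where m: "8 * Z < 2 ^ m" using real_arch_pow[of 2 "8 * Z"] by auto
    from binom_avg_fifth_spread[of m]
    show "\<forall>\<^sub>F n in sequentially. Z \<le> large_scale (E_set c) (Q_stage c n) t / small_scale (E_set c) (Q_stage c n) t"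
    proof eventually_elim
      case (elim n)
      then obtain k where k: "1 / 4 \<le> binom_avg (1 / 5) n (\<lambda>i. if i \<le> k then 1 else 0)"
        "1 / 4 \<le> binom_avg (1 / 5) n (\<lambda>i. if k + m \<le> i then 1 else 0)" by blast
      let ?L = "large_scale (E_set c) (Q_stage c n) t" and ?S = "small_scale (E_set c) (Q_stage c n) t"
      have w: "0 < width n" by (simp add: width)
      \<comment> \<open>This is where \<open>t < 1 / 8\<close> enters: the doubled threshold must
        not exceed the quartile mass \<open>1 / 4\<close>.\<close>
      have "2 * t * width n \<le> width n * (1 / 4)" using t w by simp
      also have "\<dots> \<le> width n * binom_avg (1 / 5) n (\<lambda>i. if i \<le> k then 1 else 0)"
        using k(1) w by (intro mult_left_mono) auto
      finally have L: "(1 / 2) ^ k / 8 \<le> ?L"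
        using t by (intro large_scale_ge) (auto simp: gap_sum pow_mult pow_le simp del: power_one_over)
      have "0 \<le> ?L" using L by (rule order_trans[rotated]) simp
      have "t * width n \<le> width n * (1 / 4)" using t w by simp
      then have "t * width n \<le> width n * binom_avg (1 / 5) n (\<lambda>i. if k + m \<le> i then 1 else 0)"
        using mult_left_mono[OF k(2), of "width n"] w by linarith
      then have "?S \<le> (1 / 2) ^ (k + m)"
        using t by (intro small_scale_le) (auto simp: gap_sum pow_mult pow_le)
      \<comment> \<open>The quotient estimate requires a positive denominator, which the lower bound
        for the small scale provides.\<close>
      moreover have "0 < t * width n" using t w by simp
      then have "0 < 4 * 3 ^ n * ?S" using small_scale_bound[of t n] t by linarith
      then have "0 < ?S" by (simp add: zero_less_mult_iff)
      ultimately have "((1 / 2) ^ k / 8) / (1 / 2) ^ (k + m) \<le> ?L / ?S"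
        using L \<open>0 \<le> ?L\<close> by (intro frac_le)
      moreover have "((1 / 2) ^ k / 8) / (1 / 2) ^ (k + m) = (2 ^ m / 8 :: real)"
        by (simp add: power_add field_simps)
      ultimately show "Z \<le> ?L / ?S" using m by simp
    qed
  qed
qed

theorem proposition6p7:
  shows
    "(let c = (\<lambda>n::nat. 1 - 1 / (2 * real n)); E = E_set c in
        \<exists>C0>0. \<exists>s. 0 < s \<and> s < 1 / 3 \<and>
          (\<forall>n::nat. large_scale E (Q_stage c n) s \<le> C0 * small_scale E (Q_stage c n) s)) \<and>
     (let c = (\<lambda>n::nat. 1 / 2); E = E_set c in
        \<forall>t. 0 < t \<and> t < 1 / 8 \<longrightarrow>
          filterlim (\<lambda>n. large_scale E (Q_stage c n) t / small_scale E (Q_stage c n) t) at_top sequentially)"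
  unfolding Let_def
proof (rule conjI)
  show "\<exists>C0>0. \<exists>s. 0 < s \<and> s < 1 / 3 \<and>
      (\<forall>n::nat. large_scale (E_set (\<lambda>n. 1 - 1 / (2 * real n))) (Q_stage (\<lambda>n. 1 - 1 / (2 * real n)) n) s
        \<le> C0 * small_scale (E_set (\<lambda>n. 1 - 1 / (2 * real n))) (Q_stage (\<lambda>n. 1 - 1 / (2 * real n)) n) s)"
    by (rule exI[of _ 128], rule conjI, simp, rule exI[of _ "1 / 4"])
      (simp only: harmonic_scales_comparable, simp)
qed (intro allI impI half_scales_diverge; simp)

end
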